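(* Let $\Gamma$ be a non-elementary hyperbolic group, and let $d,d_1,\ldots,d_n$ be the word metrics on $\Gamma$ associated to finite symmetric generating sets $S,S_1,\ldots,S_n$ of $\Gamma$ respectively. Then the joint translation spectrum $\mathcal{J}_d(d_1,\ldots,d_n)\subset\mathbb{R}^n$ is a polytope.
   Context: A non-elementary hyperbolic group $\Gamma$ is a finitely generated group, not virtually cyclic, whose word metrics (for finite symmetric generating sets) are Gromov hyperbolic; $o$ is its identity. Joint translation spectrum: write $\mathbf{D}_d(x)=\frac{1}{d(o,x)}(d_1(o,x),\ldots,d_n(o,x))$ for $x\ne o$, and for $R,T>0$ let $S_R(T)=\{x\in\Gamma:|d(o,x)-T|\le R,\ d(o,x)>0\}$. For all $R$ large enough the sets $\mathbf{D}_d(S_R(T))$ converge in the Hausdorff metric as $T\to\infty$ to a compact convex subset of $\mathbb{R}^n$, independent of $R$; this limit is denoted $\mathcal{J}_d(d_1,\ldots,d_n)$. A polytope is the convex hull of finitely many points. *)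

theory Defs
  imports "HOL-Analysis.Analysis" "HOL-Algebra.Elementary_Groups"
begin

definition finite_symmetric_generating_set :: "('a, 'b) monoid_scheme \<Rightarrow> 'a set \<Rightarrow> bool" where
  "finite_symmetric_generating_set G S \<longleftrightarrow>
     finite S \<and> S \<subseteq> carrier G \<and> (\<forall>s\<in>S. inv\<^bsub>G\<^esub> s \<in> S) \<and> generate G S = carrier G"

text \<open>Meaningful when \<open>S\<close> is a symmetric generating set; then the set of admissible lengths is
  nonempty for every \<open>x\<close> in the carrier.\<close>

definition word_length :: "('a, 'b) monoid_scheme \<Rightarrow> 'a set \<Rightarrow> 'a \<Rightarrow> nat" where
  "word_length G S x =
     (LEAST k. \<exists>ws. length ws = k \<and> set ws \<subseteq> S \<and> foldr (\<lambda>s y. s \<otimes>\<^bsub>G\<^esub> y) ws \<one>\<^bsub>G\<^esub> = x)"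

definition word_metric :: "('a, 'b) monoid_scheme \<Rightarrow> 'a set \<Rightarrow> 'a \<Rightarrow> 'a \<Rightarrow> real" where
  "word_metric G S x y = real (word_length G S (inv\<^bsub>G\<^esub> x \<otimes>\<^bsub>G\<^esub> y))"

definition gromov_product :: "('a \<Rightarrow> 'a \<Rightarrow> real) \<Rightarrow> 'a \<Rightarrow> 'a \<Rightarrow> 'a \<Rightarrow> real" where
  "gromov_product d w x y = (d x w + d y w - d x y) / 2"

definition gromov_hyperbolic :: "'a set \<Rightarrow> ('a \<Rightarrow> 'a \<Rightarrow> real) \<Rightarrow> bool" where
  "gromov_hyperbolic X d \<longleftrightarrow>
     (\<exists>\<delta>\<ge>0. \<forall>w\<in>X. \<forall>x\<in>X. \<forall>y\<in>X. \<forall>z\<in>X.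
        gromov_product d w x z \<ge> min (gromov_product d w x y) (gromov_product d w y z) - \<delta>)"

definition virtually_cyclic :: "('a, 'b) monoid_scheme \<Rightarrow> bool" where
  "virtually_cyclic G \<longleftrightarrow>
     (\<exists>H. subgroup H G \<and> finite (rcosets\<^bsub>G\<^esub> H) \<and> cyclic_group (subgroup_generated G H))"

text \<open>Over the symmetric sets, the existence clause is just finite generation: closing a finite
  generating set under inverses keeps it finite.\<close>

definition non_elementary_hyperbolic_group :: "('a, 'b) monoid_scheme \<Rightarrow> bool" where
  "non_elementary_hyperbolic_group G \<longleftrightarrow>
     group G \<and>
     (\<exists>S. finite_symmetric_generating_set G S) \<and>
     (\<forall>S. finite_symmetric_generating_set G S \<longrightarrow>
            gromov_hyperbolic (carrier G) (word_metric G S)) \<and>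
     \<not> virtually_cyclic G"

text \<open>Extended-real valued, so that no boundedness or nonemptiness is needed: the distance of a
  nonempty set from the empty set is \<open>\<infinity>\<close>.\<close>

definition hausdorff_distance :: "'a::metric_space set \<Rightarrow> 'a set \<Rightarrow> ennreal" where
  "hausdorff_distance A B =
     max (SUP a\<in>A. INF b\<in>B. ennreal (dist a b)) (SUP b\<in>B. INF a\<in>A. ennreal (dist a b))"

text \<open>In the following, \<open>D i\<close> is the metric \<open>d\<^sub>i\<close>.\<close>

definition displacement_ratio ::
  "('a, 'b) monoid_scheme \<Rightarrow> ('a \<Rightarrow> 'a \<Rightarrow> real) \<Rightarrow> ('n::finite \<Rightarrow> 'a \<Rightarrow> 'a \<Rightarrow> real) \<Rightarrow> 'a \<Rightarrow> real^'n" where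
  "displacement_ratio G d D x = (\<chi> i. D i \<one>\<^bsub>G\<^esub> x / d \<one>\<^bsub>G\<^esub> x)"

definition thick_sphere ::
  "('a, 'b) monoid_scheme \<Rightarrow> ('a \<Rightarrow> 'a \<Rightarrow> real) \<Rightarrow> real \<Rightarrow> real \<Rightarrow> 'a set" where
  "thick_sphere G d R T =
     {x \<in> carrier G. \<bar>d \<one>\<^bsub>G\<^esub> x - T\<bar> \<le> R \<and> d \<one>\<^bsub>G\<^esub> x > 0}"

definition is_joint_translation_limit ::
  "('a, 'b) monoid_scheme \<Rightarrow> ('a \<Rightarrow> 'a \<Rightarrow> real) \<Rightarrow> ('n::finite \<Rightarrow> 'a \<Rightarrow> 'a \<Rightarrow> real) \<Rightarrow>
     (real^'n) set \<Rightarrow> bool" where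
  "is_joint_translation_limit G d D J \<longleftrightarrow>
     compact J \<and>
     (\<exists>R\<^sub>0>0. \<forall>R\<ge>R\<^sub>0.
        ((\<lambda>T. hausdorff_distance (displacement_ratio G d D ` thick_sphere G d R T) J)
           \<longlongrightarrow> 0) at_top)"

text \<open>The limit is unique if it exists (\<open>is_joint_translation_limit_unique\<close> below); where it does not
  exist the spectrum is an unspecified set.\<close>

definition joint_translation_spectrum ::
  "('a, 'b) monoid_scheme \<Rightarrow> ('a \<Rightarrow> 'a \<Rightarrow> real) \<Rightarrow> ('n::finite \<Rightarrow> 'a \<Rightarrow> 'a \<Rightarrow> real) \<Rightarrow>
     (real^'n) set" where
  "joint_translation_spectrum G d D = (THE J. is_joint_translation_limit G d D J)"

lemma hausdorff_distance_lessD: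
  assumes "hausdorff_distance A B < ennreal e"
  shows "a \<in> A \<Longrightarrow> \<exists>b\<in>B. dist a b < e" and "b \<in> B \<Longrightarrow> \<exists>a\<in>A. dist a b < e"
proof -
  have 1: "(SUP a\<in>A. INF b\<in>B. ennreal (dist a b)) < ennreal e"
    and 2: "(SUP b\<in>B. INF a\<in>A. ennreal (dist a b)) < ennreal e"
    using assms unfolding hausdorff_distance_def by auto
  show "\<exists>b\<in>B. dist a b < e" if "a \<in> A"
  proof -
    have "(INF b\<in>B. ennreal (dist a b)) < ennreal e"
      using 1 SUP_lessD that by fastforce
    then show ?thesis
      by (auto simp: INF_less_iff ennreal_less_iff)
  qed
  show "\<exists>a\<in>A. dist a b < e" if "b \<in> B"
  proof -
    have "(INF a\<in>A. ennreal (dist a b)) < ennreal e"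
      using 2 SUP_lessD that by fastforce
    then show ?thesis
      by (auto simp: INF_less_iff ennreal_less_iff)
  qed
qed

lemma hausdorff_limit_subset:
  assumes "((\<lambda>T. hausdorff_distance (A T) J) \<longlongrightarrow> 0) F" "((\<lambda>T. hausdorff_distance (A T) K) \<longlongrightarrow> 0) F"
    and "F \<noteq> bot" "closed K"
  shows "J \<subseteq> K"
proof
  fix x assume x: "x \<in> J"
  have "\<exists>k\<in>K. dist k x < e" if "e > 0" for e
  proof -
    have e: "0 < ennreal (e/2)" using that by simp
    have "\<forall>\<^sub>F T in F. hausdorff_distance (A T) J < ennreal (e/2) \<and> hausdorff_distance (A T) K < ennreal (e/2)"
      using order_tendstoD(2)[OF assms(1) e] order_tendstoD(2)[OF assms(2) e]
      by (rule eventually_conj)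
    then obtain T where T: "hausdorff_distance (A T) J < ennreal (e/2)"
        "hausdorff_distance (A T) K < ennreal (e/2)"
      using eventually_happens assms(3) by blast
    obtain a where a: "a \<in> A T" "dist a x < e/2" using hausdorff_distance_lessD(2)[OF T(1) x] by blast
    obtain k where k: "k \<in> K" "dist a k < e/2" using hausdorff_distance_lessD(1)[OF T(2) a(1)] by blast
    have "dist k x < e" using a(2) k(2) dist_triangle2[of k x a] by (metis dist_commute dist_triangle_half_l)
    with k(1) show ?thesis by blast
  qed
  then have "x \<in> closure K" by (auto simp: closure_approachable)
  with \<open>closed K\<close> show "x \<in> K" by simp
qed

lemma is_joint_translation_limit_unique:
  assumes "is_joint_translation_limit G d D J" "is_joint_translation_limit G d D K"
  shows "J = K"
proof -
  obtain R\<^sub>1 R\<^sub>2 where R: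
    "\<And>R. R \<ge> R\<^sub>1 \<Longrightarrow> ((\<lambda>T. hausdorff_distance (displacement_ratio G d D ` thick_sphere G d R T) J) \<longlongrightarrow> 0) at_top"
    "\<And>R. R \<ge> R\<^sub>2 \<Longrightarrow> ((\<lambda>T. hausdorff_distance (displacement_ratio G d D ` thick_sphere G d R T) K) \<longlongrightarrow> 0) at_top"
    using assms unfolding is_joint_translation_limit_def by blast
  have cl: "closed J" "closed K"
    using assms by (auto simp: is_joint_translation_limit_def compact_imp_closed)
  note L = R(1)[of "max R\<^sub>1 R\<^sub>2", simplified] R(2)[of "max R\<^sub>1 R\<^sub>2", simplified]
  show ?thesis
    using hausdorff_limit_subset[OF L(1,2) _ cl(2)] hausdorff_limit_subset[OF L(2,1) _ cl(1)] by auto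
qed

lemma joint_translation_spectrum_eqI:
  "is_joint_translation_limit G d D J \<Longrightarrow> joint_translation_spectrum G d D = J"
  unfolding joint_translation_spectrum_def
  by (rule the_equality) (auto dest: is_joint_translation_limit_unique)

end

theory Submission
  imports Defs "HOL-Real_Asymp.Real_Asymp"
begin

text \<open>
  Let \<open>L x\<close> be the vector of all word lengths of \<open>x\<close>, the base length \<open>\<bar>x\<bar>\<close> for \<open>S\<close> included.  The theorem
  holds because, up to a bounded error, the set of all \<open>L x\<close> consists of the sums of elements of one
  finite set \<open>V\<close> of vectors, repetitions allowed.  Dividing by the base coordinate turns such sums
  into convex combinations of the points \<open>v\<^sub>i / v\<^sub>0\<close>, and the bounded error disappears on large spheres,
  so the spectrum is the convex hull of these finitely many points.

  That every \<open>L x\<close> is such a sum (\<open>lengths_decompose\<close>) is a pumping argument along an \<open>S\<close>-geodesic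
  from \<open>\<one>\<close> to \<open>x\<close>.  Record at each point \<open>y\<close> the differences \<open>L (y \<otimes> g) - L y\<close> for \<open>g\<close> in a large ball; only
  finitely many records occur.  The record determines how all the lengths grow along any
  geodesic continuation (\<open>local_type_determines_extensions\<close>), because geodesics for the other generating
  sets also pass within bounded distance of \<open>y\<close> (\<open>geodesics_fellow_travel\<close>, an application of the
  stability of quasi-geodesics).  If the same record occurs twice, say at \<open>y\<close> and at \<open>y \<otimes> u\<close>, then the
  segment \<open>u\<close> can be cut out, which lowers \<open>L x\<close> by exactly \<open>v = L (y \<otimes> u) - L y\<close>, and it can be repeated,
  which gives \<open>L (y \<otimes> u\<^sup>p) = L y + p v\<close>.  A repetition occurs within a bounded number of steps, so only
  finitely many vectors \<open>v\<close> are needed.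

  Conversely each sum with all multiplicities large is nearly attained (\<open>translates_concatenate\<close>): the
  element \<open>u\<^sub>1\<^sup>a f u\<^sub>2\<^sup>b f' u\<^sub>3\<^sup>c \<dots>\<close> has the required lengths if the connectors \<open>f, f', \<dots>\<close> prevent backtracking.  A
  connector between \<open>u\<close> and \<open>u'\<close> fails to exist only if every group element takes the end of the ray
  \<open>u'\<^sup>q\<close> to the end of the ray \<open>u\<^sup>-\<^sup>p\<close>; in that case a pigeonhole argument in a ball shows that \<open>u'\<close>
  generates a subgroup of finite index (\<open>finite_index_if_powers_asymptotic\<close>), which is excluded for a
  non-elementary group.  Both halves together also prove that the limit defining the
  spectrum exists.
\<close>

section \<open>Stability of quasi-geodesics in hyperbolic spaces\<close>

locale hyperbolic_distance =
  fixes X :: "'a set" and d :: "'a \<Rightarrow> 'a \<Rightarrow> real" and \<delta> :: real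
  assumes dist_self [simp]: "x \<in> X \<Longrightarrow> d x x = 0"
    and dist_sym: "x \<in> X \<Longrightarrow> y \<in> X \<Longrightarrow> d x y = d y x"
    and dist_triangle: "x \<in> X \<Longrightarrow> y \<in> X \<Longrightarrow> z \<in> X \<Longrightarrow> d x z \<le> d x y + d y z"
    and delta_nonneg: "\<delta> \<ge> 0"
    and four_point: "w \<in> X \<Longrightarrow> x \<in> X \<Longrightarrow> y \<in> X \<Longrightarrow> z \<in> X \<Longrightarrow>
      min (gromov_product d w x y) (gromov_product d w y z) \<le> gromov_product d w x z + \<delta>"
begin

abbreviation gp :: "'a \<Rightarrow> 'a \<Rightarrow> 'a \<Rightarrow> real" where
  "gp \<equiv> gromov_product d"

lemma dist_nonneg: "x \<in> X \<Longrightarrow> y \<in> X \<Longrightarrow> 0 \<le> d x y"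
  using dist_triangle[of x y x] by (simp add: dist_sym)

lemma gp_commute: "x \<in> X \<Longrightarrow> y \<in> X \<Longrightarrow> gp w x y = gp w y x"
  by (simp add: gromov_product_def dist_sym)

text \<open>The four-point inequality loses \<open>\<delta>\<close> each time two halves of a chain are joined, so bisection costs
  only logarithmically many \<open>\<delta>\<close>.  This is the discrete form of the exponential divergence of
  geodesics: a path that avoids a large ball around a point of a geodesic must be exponentially long.\<close>

lemma gromov_product_chain:
  assumes "y \<in> X" "0 < n" "n \<le> 2 ^ k" "\<And>i. i \<le> n \<Longrightarrow> p i \<in> X"
    and "\<And>i. i < n \<Longrightarrow> m \<le> gp y (p i) (p (Suc i))"
  shows "m - real k * \<delta> \<le> gp y (p 0) (p n)"
  using assms(2-)
proof (induction k arbitrary: n p)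
  case 0
  then have "n = 1" by simp
  with 0 show ?case by simp
next
  case (Suc k)
  show ?case
  proof (cases "n \<le> 2 ^ k")
    case True
    have "m - real k * \<delta> \<le> gp y (p 0) (p n)"
      using Suc True by blast
    moreover have "real k * \<delta> \<le> real (Suc k) * \<delta>"
      using delta_nonneg by (simp add: algebra_simps)
    ultimately show ?thesis by linarith
  next
    case False
    define h :: nat where "h = 2 ^ k"
    have h: "0 < h" "h < n" "n - h \<le> 2 ^ k"
      using False Suc.prems by (auto simp: h_def)
    have 1: "m - real k * \<delta> \<le> gp y (p 0) (p h)"
      using h Suc.prems by (intro Suc.IH) (auto simp: h_def)
    have 2: "m - real k * \<delta> \<le> gp y ((\<lambda>i. p (h + i)) 0) ((\<lambda>i. p (h + i)) (n - h))"
    proof (rule Suc.IH)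
      show "m \<le> gp y (p (h + i)) (p (h + Suc i))" if "i < n - h" for i
        using Suc.prems(4)[of "h + i"] that by simp
    qed (use h Suc.prems in auto)
    have "min (gp y (p 0) (p h)) (gp y (p h) (p n)) \<le> gp y (p 0) (p n) + \<delta>"
      using assms(1) Suc.prems h by (intro four_point) auto
    with 1 2 h show ?thesis by (simp add: algebra_simps min_def split: if_splits)
  qed
qed

text \<open>A path with short steps that stays far from \<open>y\<close> has large Gromov products between consecutive points.
  The indices \<open>a\<close> and \<open>b\<close> come in either order, as they are found by proximity to points of a geodesic.\<close>

lemma gromov_product_path:
  assumes "y \<in> X" "a \<le> n" "b \<le> n" "\<And>i. i \<le> n \<Longrightarrow> p i \<in> X" "\<kappa> \<ge> 0"
    and far: "\<And>i. i \<le> n \<Longrightarrow> D \<le> d y (p i)"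
    and step: "\<And>i. i < n \<Longrightarrow> d (p i) (p (Suc i)) \<le> \<kappa>"
    and k: "\<bar>real a - real b\<bar> \<le> 2 ^ k"
  shows "D - \<kappa> / 2 - real k * \<delta> \<le> gp y (p a) (p b)"
proof -
  have *: "D - \<kappa> / 2 - real k * \<delta> \<le> gp y (p a) (p b)"
    if "a \<le> b" "b \<le> n" "real b - real a \<le> 2 ^ k" for a b
  proof (cases "a = b")
    case True
    then have "gp y (p a) (p b) = d y (p b)"
      using that assms by (simp add: gromov_product_def dist_sym)
    moreover have "0 \<le> real k * \<delta>" using delta_nonneg by simp
    ultimately show ?thesis using far[of b] that assms(5) by linarith
  next
    case False
    have "real (b - a) \<le> real (2 ^ k)" using that by simp
    then have bk: "b - a \<le> 2 ^ k" by linarith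
    have "D - \<kappa> / 2 - real k * \<delta> \<le> gp y (p (a + 0)) (p (a + (b - a)))"
    proof (rule gromov_product_chain[where p = "\<lambda>i. p (a + i)"])
      fix i assume i: "i < b - a"
      have "D \<le> d y (p (a + i))" "D \<le> d y (p (a + Suc i))" "d (p (a + i)) (p (a + Suc i)) \<le> \<kappa>"
        using i that by (auto intro!: far step)
      then show "D - \<kappa> / 2 \<le> gp y (p (a + i)) (p (a + Suc i))"
        using i that assms(1,4) by (simp add: gromov_product_def dist_sym field_simps)
    qed (use that False bk assms in auto)
    then show ?thesis using that by simp
  qed
  show ?thesis
  proof (cases "a \<le> b")
    case True
    then show ?thesis using * k assms by simp
  next
    case False
    then have "D - \<kappa> / 2 - real k * \<delta> \<le> gp y (p b) (p a)" using * k assms by simp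
    then show ?thesis using assms gp_commute by metis
  qed
qed

text \<open>The step \<open>s\<close> need not be \<open>1\<close>: the powers of a translating element form a geodesic whose step is the
  length of that element.\<close>

definition geodesic_upto :: "nat \<Rightarrow> real \<Rightarrow> (nat \<Rightarrow> 'a) \<Rightarrow> bool" where
  "geodesic_upto l s q \<longleftrightarrow>
     (\<forall>i\<le>l. q i \<in> X) \<and> (\<forall>i\<le>l. \<forall>j\<le>l. d (q i) (q j) = s * \<bar>real i - real j\<bar>)"

definition quasigeodesic_upto :: "nat \<Rightarrow> real \<Rightarrow> (nat \<Rightarrow> 'a) \<Rightarrow> bool" where
  "quasigeodesic_upto n \<kappa> p \<longleftrightarrow>
     (\<forall>i\<le>n. p i \<in> X) \<and> (\<forall>i<n. d (p i) (p (Suc i)) \<le> \<kappa>) \<and>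
     (\<forall>i\<le>n. \<forall>j\<le>n. \<bar>real i - real j\<bar> \<le> \<kappa> * d (p i) (p j))"

text \<open>This is one half of the stability of quasi-geodesics (the Morse lemma).  At a point \<open>y\<close> of the geodesic
  of maximal distance \<open>D\<close> from the path, walk about \<open>2D\<close> along the geodesic in both directions, or to
  its end if that comes first.  The two points reached have Gromov product \<open>0\<close> at \<open>y\<close>.  They are also joined by
  a detour of length linear in \<open>D\<close> that runs along the path and keeps distance \<open>D\<close> from \<open>y\<close>, which by
  \<open>gromov_product_path\<close> makes their product at least \<open>D - O(log D)\<close>.  Hence \<open>D\<close> is bounded.\<close>

lemma geodesic_near_quasigeodesic:
  assumes "\<kappa> \<ge> 1"
  shows "\<exists>D0. \<forall>l q n p t. geodesic_upto l 1 q \<and> quasigeodesic_upto n \<kappa> p \<and>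
    p 0 = q 0 \<and> p n = q l \<and> t \<le> l \<longrightarrow> (\<exists>i\<le>n. d (q t) (p i) \<le> D0)"
proof -
  \<comment> \<open>The asymptotic comparison needs a positive coefficient, and \<open>\<delta>\<close> may vanish.\<close>
  define \<epsilon> where "\<epsilon> = \<delta> + 1"
  have \<epsilon>: "\<epsilon> > 0" "\<delta> \<le> \<epsilon>" using delta_nonneg by (auto simp: \<epsilon>_def)
  have \<kappa>: "\<kappa> > 0" using assms by simp
  have "\<forall>\<^sub>F D in at_top. \<kappa> / 2 + (log 2 (6 * \<kappa> * (D + 1)) + 3) * \<epsilon> < D"
    using \<epsilon>(1) \<kappa> by real_asymp
  then obtain D0 where D0: "\<And>D. D \<ge> D0 \<Longrightarrow> \<kappa> / 2 + (log 2 (6 * \<kappa> * (D + 1)) + 3) * \<epsilon> < D"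
    by (auto simp: eventually_at_top_linorder)
  show ?thesis
  proof (intro exI[of _ "max D0 0"] allI impI, elim conjE)
    fix l q n p t
    assume q: "geodesic_upto l 1 q" and ends: "p 0 = q 0" "p n = q l"
      and p: "quasigeodesic_upto n \<kappa> p" and "t \<le> l"
    have pX: "\<And>i. i \<le> n \<Longrightarrow> p i \<in> X"
      and step: "\<And>i. i < n \<Longrightarrow> d (p i) (p (Suc i)) \<le> \<kappa>"
      and qi: "\<And>i j. i \<le> n \<Longrightarrow> j \<le> n \<Longrightarrow> \<bar>real i - real j\<bar> \<le> \<kappa> * d (p i) (p j)"
      using p by (auto simp: quasigeodesic_upto_def)
    have qX: "\<And>i. i \<le> l \<Longrightarrow> q i \<in> X" and qd: "\<And>i j. i \<le> l \<Longrightarrow> j \<le> l \<Longrightarrow> d (q i) (q j) = \<bar>real i - real j\<bar>"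
      using q by (auto simp: geodesic_upto_def)
    define m where "m s = Min ((\<lambda>i. d (q s) (p i)) ` {..n})" for s
    have m_le: "m s \<le> d (q s) (p i)" if "i \<le> n" for s i
      using that by (auto simp: m_def)
    have m_ex: "\<exists>i\<le>n. d (q s) (p i) = m s" for s
    proof -
      have "m s \<in> (\<lambda>i. d (q s) (p i)) ` {..n}" unfolding m_def by (rule Min_in) auto
      then show ?thesis by auto
    qed
    define D where "D = Max (m ` {..l})"
    have "D \<in> m ` {..l}" unfolding D_def by (rule Max_in) auto
    then obtain s where s: "s \<le> l" "m s = D" by auto
    have m_le_D: "m r \<le> D" if "r \<le> l" for r using that by (auto simp: D_def)
    have D_nonneg: "0 \<le> D"
      using m_ex[of s] dist_nonneg qX pX s by metis
    define N where "N = nat \<lceil>D\<rceil>"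
    have N: "D \<le> real N" "real N < D + 1" using D_nonneg by (simp_all add: N_def) linarith+
    let ?y = "q s"
    have y: "?y \<in> X" using qX s by blast
    have far: "D \<le> d ?y (p i)" if "i \<le> n" for i using m_le[OF that, of s] s by simp
    \<comment> \<open>A point where the walk along the geodesic stops is hooked onto the path: at a stop
      in the interior a path point lies within \<open>D\<close>, and an end of the geodesic is itself a path point.\<close>
    have hook: "\<exists>a\<le>n. D \<le> gp ?y (q r) (p a) \<and> d ?y (p a) \<le> 3 * real N"
      if r: "r \<le> l" and disj: "\<bar>real r - real s\<bar> = 2 * real N \<or> \<bar>real r - real s\<bar> \<le> 2 * real N \<and> (r = 0 \<or> r = l)" for r
    proof (cases "\<bar>real r - real s\<bar> = 2 * real N")
      case True
      obtain a where a: "a \<le> n" "d (q r) (p a) = m r" using m_ex by blast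
      have *: "d (q r) (p a) \<le> D" using a m_le_D[OF r] by simp
      have rs: "d (q r) ?y = 2 * real N" "d ?y (q r) = 2 * real N"
        using True r s qd by (auto simp: abs_minus_commute)
      have "d ?y (p a) \<le> d ?y (q r) + d (q r) (p a)"
        using dist_triangle y qX r pX a by blast
      moreover have "d (p a) ?y = d ?y (p a)" using dist_sym y pX a by blast
      ultimately show ?thesis
        using a(1) * rs far[OF a(1)] N by (intro exI[of _ a]) (auto simp: gromov_product_def)
    next
      case False
      then have le: "\<bar>real r - real s\<bar> \<le> 2 * real N" and "r = 0 \<or> r = l" using disj by auto
      then obtain a where a: "a \<le> n" "q r = p a" using ends by (metis le_refl zero_le)
      have "d ?y (p a) \<le> 2 * real N" using qd[OF s(1) r] a(2) le by (simp add: abs_minus_commute)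
      moreover have "gp ?y (q r) (p a) = d ?y (p a)"
        using a pX y by (simp add: gromov_product_def dist_sym)
      ultimately show ?thesis using far[OF a(1)] a(1) by (intro exI[of _ a]) auto
    qed
    define r1 where "r1 = (if 2 * N \<le> s then s - 2 * N else 0)"
    define r2 where "r2 = (if s + 2 * N \<le> l then s + 2 * N else l)"
    have r: "r1 \<le> s" "s \<le> r2" "r2 \<le> l" using s by (auto simp: r1_def r2_def)
    have "\<exists>a\<le>n. D \<le> gp ?y (q r1) (p a) \<and> d ?y (p a) \<le> 3 * real N"
      using r by (intro hook) (auto simp: r1_def)
    then obtain a where a: "a \<le> n" "D \<le> gp ?y (q r1) (p a)" "d ?y (p a) \<le> 3 * real N" by blast
    have "\<exists>b\<le>n. D \<le> gp ?y (q r2) (p b) \<and> d ?y (p b) \<le> 3 * real N"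
      using r s by (intro hook) (auto simp: r2_def)
    then obtain b where b: "b \<le> n" "D \<le> gp ?y (q r2) (p b)" "d ?y (p b) \<le> 3 * real N" by blast
    have zero: "gp ?y (q r1) (q r2) = 0"
      using r qd s by (simp add: gromov_product_def)
    have "d (p a) (p b) \<le> d (p a) ?y + d ?y (p b)" using a b y pX dist_triangle by blast
    also have "\<dots> \<le> 6 * real N" using a b y pX dist_sym[of "p a" ?y] by simp
    finally have "\<kappa> * d (p a) (p b) \<le> \<kappa> * (6 * real N)" using \<kappa> by simp
    with qi[OF a(1) b(1)] have "\<bar>real a - real b\<bar> \<le> \<kappa> * (6 * real N)" by linarith
    also have "\<dots> \<le> \<kappa> * (6 * (D + 1))" using N \<kappa> by (intro mult_left_mono) auto
    finally have ab: "\<bar>real a - real b\<bar> \<le> 6 * \<kappa> * (D + 1)" by (simp add: algebra_simps)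
    define x where "x = log 2 (6 * \<kappa> * (D + 1))"
    have pos: "6 * \<kappa> * (D + 1) \<ge> 1"
      using assms D_nonneg mult_mono[of 1 \<kappa> 1 "D + 1"] by simp
    then have x: "x \<ge> 0" "2 powr x = 6 * \<kappa> * (D + 1)" by (auto simp: x_def)
    define k where "k = nat \<lceil>x\<rceil>"
    have k: "x \<le> real k" "real k < x + 1" using x(1) by (simp_all add: k_def) linarith+
    have "2 powr x \<le> 2 powr real k" using k by simp
    then have "\<bar>real a - real b\<bar> \<le> 2 ^ k" using ab x by (simp add: powr_realpow)
    then have path: "D - \<kappa> / 2 - real k * \<delta> \<le> gp ?y (p a) (p b)"
      by (intro gromov_product_path[OF y a(1) b(1)]) (use pX far step \<kappa> in auto)
    have X: "q r1 \<in> X" "q r2 \<in> X" "p a \<in> X" "p b \<in> X" using r s qX pX a b by auto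
    have "min (gp ?y (q r1) (p a)) (gp ?y (p a) (q r2)) \<le> \<delta>"
      using four_point[OF y X(1,3,2)] zero by simp
    moreover have "min (gp ?y (p a) (p b)) (gp ?y (p b) (q r2)) \<le> gp ?y (p a) (q r2) + \<delta>"
      using four_point[OF y X(3,4,2)] by simp
    ultimately have "min D (D - \<kappa> / 2 - real k * \<delta>) \<le> 2 * \<delta>"
      using a(2) b(2) path delta_nonneg gp_commute[OF X(2,4), of ?y] by (auto simp: min_def split: if_splits)
    moreover have "0 \<le> real k * \<delta>" using delta_nonneg by simp
    ultimately have "D \<le> \<kappa> / 2 + (real k + 2) * \<delta>" using \<kappa> by (auto simp: algebra_simps)
    also have "\<dots> \<le> \<kappa> / 2 + (x + 3) * \<epsilon>"
      using k \<epsilon> x delta_nonneg by (intro add_left_mono mult_mono) auto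
    finally have "D < D0" using D0[of D] by (fastforce simp: x_def)
    moreover obtain i where "i \<le> n" "d (q t) (p i) = m t" using m_ex by blast
    ultimately show "\<exists>i\<le>n. d (q t) (p i) \<le> max D0 0"
      using m_le_D[OF \<open>t \<le> l\<close>] by (intro exI[of _ i]) auto
  qed
qed

text \<open>The point sought is the one at distance \<open>T = \<langle>y, z\<rangle>\<close>, the product taken at \<open>x\<close>, from the first end \<open>x\<close>: it
  balances the two bounds that the four-point inequality gives.  The step \<open>s\<close> is the rounding error.\<close>

lemma near_geodesic:
  assumes q: "geodesic_upto l s q" and "s > 0" and y: "y \<in> X" and c: "gp y (q 0) (q l) \<le> c"
  obtains t where "t \<le> l" "d y (q t) \<le> c + 2 * \<delta> + s"
proof -
  have qX: "\<And>i. i \<le> l \<Longrightarrow> q i \<in> X" and qd: "\<And>i j. i \<le> l \<Longrightarrow> j \<le> l \<Longrightarrow> d (q i) (q j) = s * \<bar>real i - real j\<bar>"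
    using q by (auto simp: geodesic_upto_def)
  let ?x = "q 0" and ?z = "q l"
  have X: "?x \<in> X" "?z \<in> X" using qX by auto
  have xz: "d ?x ?z = s * real l" using qd[of 0 l] by simp
  define T where "T = (d ?x y + s * real l - d y ?z) / 2"
  have "0 \<le> T" using dist_triangle[of y ?x ?z] X y xz by (simp add: T_def dist_sym)
  have "T \<le> s * real l" using dist_triangle[of ?x ?z y] X y xz by (simp add: T_def dist_sym)
  define t where "t = nat \<lfloor>T / s\<rfloor>"
  have "real t \<le> T / s" "T / s < real t + 1" using \<open>0 \<le> T\<close> \<open>s > 0\<close> by (auto simp: t_def)
  then have t: "s * real t \<le> T" "T < s * real t + s" using \<open>s > 0\<close> by (auto simp: field_simps)
  then have "s * real t \<le> s * real l" using \<open>T \<le> s * real l\<close> by linarith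
  then have tl: "t \<le> l" using \<open>s > 0\<close> by simp
  have qt: "q t \<in> X" using qX tl by simp
  have xq: "d ?x (q t) = s * real t" and qz: "d (q t) ?z = s * real l - s * real t"
    using qd[of 0 t] qd[of t l] tl by (auto simp: algebra_simps)
  have "min (gp (q t) ?x y) (gp (q t) y ?z) \<le> \<delta>"
    using four_point[OF qt X(1) y X(2)] xq qz xz dist_sym[OF qt X(2)]
    by (simp add: gromov_product_def)
  moreover have "gp y ?x ?z = (d ?x y + d y ?z - s * real l) / 2"
    using xz X y by (simp add: gromov_product_def dist_sym)
  ultimately have "d y (q t) \<le> c + 2 * \<delta> + s"
    using c t xq qz dist_sym[OF qt X(2)] dist_sym[OF y X(2)] \<open>s > 0\<close> unfolding T_def
    by (simp add: gromov_product_def min_def field_simps split: if_splits)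
  with tl that show ?thesis by blast
qed

end

section \<open>Word lengths as integer-valued geodesic lengths\<close>

lemma (in group) mult_inv_cancel: "x \<in> carrier G \<Longrightarrow> y \<in> carrier G \<Longrightarrow> x \<otimes> (inv x \<otimes> y) = y"
  by (simp add: m_assoc[symmetric])

lemma (in group) inv_mult_cancel_left: "x \<in> carrier G \<Longrightarrow> y \<in> carrier G \<Longrightarrow> inv x \<otimes> (x \<otimes> y) = y"
  by (simp add: m_assoc[symmetric])

lemma (in group) inv_mult_cancel: "x \<in> carrier G \<Longrightarrow> y \<in> carrier G \<Longrightarrow> z \<in> carrier G \<Longrightarrow>
    inv (x \<otimes> y) \<otimes> (x \<otimes> z) = inv y \<otimes> z"
  by (simp add: inv_mult_group m_assoc inv_mult_cancel_left)

definition left_metric :: "('a, 'b) monoid_scheme \<Rightarrow> ('a \<Rightarrow> nat) \<Rightarrow> 'a \<Rightarrow> 'a \<Rightarrow> real" where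
  "left_metric G len x y = real (len (inv\<^bsub>G\<^esub> x \<otimes>\<^bsub>G\<^esub> y))"

text \<open>These are the only properties of a word length that matter below: it is a norm on the group, its balls
  are finite, and every element can be reached by unit steps that never waste length.\<close>

locale length_function = group G for G :: "('a, 'b) monoid_scheme" (structure) +
  fixes len :: "'a \<Rightarrow> nat"
  assumes len_eq_0: "x \<in> carrier G \<Longrightarrow> len x = 0 \<longleftrightarrow> x = \<one>"
    and len_inv: "x \<in> carrier G \<Longrightarrow> len (inv x) = len x"
    and len_mult: "x \<in> carrier G \<Longrightarrow> y \<in> carrier G \<Longrightarrow> len (x \<otimes> y) \<le> len x + len y"
    and len_split: "x \<in> carrier G \<Longrightarrow> len x = Suc k \<Longrightarrow>
      \<exists>y\<in>carrier G. \<exists>s\<in>carrier G. x = y \<otimes> s \<and> len y = k \<and> len s = 1"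
    and finite_unit: "finite {x \<in> carrier G. len x = 1}"
begin

lemma len_one [simp]: "len \<one> = 0"
  using len_eq_0 by simp

abbreviation gdist :: "'a \<Rightarrow> 'a \<Rightarrow> real" where
  "gdist \<equiv> left_metric G len"

lemma gdist_self: "x \<in> carrier G \<Longrightarrow> gdist x x = 0"
  by (simp add: left_metric_def)

lemma gdist_one: "x \<in> carrier G \<Longrightarrow> gdist \<one> x = real (len x)"
  by (simp add: left_metric_def)

lemma gdist_sym: "x \<in> carrier G \<Longrightarrow> y \<in> carrier G \<Longrightarrow> gdist x y = gdist y x"
  using len_inv[of "inv x \<otimes> y"] by (simp add: left_metric_def inv_mult_group)

lemma gdist_triangle:
  assumes "x \<in> carrier G" "y \<in> carrier G" "z \<in> carrier G"
  shows "gdist x z \<le> gdist x y + gdist y z"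
proof -
  have "inv x \<otimes> z = (inv x \<otimes> y) \<otimes> (inv y \<otimes> z)"
    using assms by (simp add: m_assoc mult_inv_cancel)
  then show ?thesis using assms len_mult[of "inv x \<otimes> y" "inv y \<otimes> z"]
    by (simp add: left_metric_def flip: of_nat_add)
qed

lemma gdist_translate: "g \<in> carrier G \<Longrightarrow> x \<in> carrier G \<Longrightarrow> y \<in> carrier G \<Longrightarrow>
    gdist (g \<otimes> x) (g \<otimes> y) = gdist x y"
  by (simp add: left_metric_def inv_mult_cancel)

lemma gdist_mult_right: "x \<in> carrier G \<Longrightarrow> y \<in> carrier G \<Longrightarrow> gdist x (x \<otimes> y) = real (len y)"
  by (simp add: left_metric_def m_assoc[symmetric])

lemma finite_ball: "finite {x \<in> carrier G. len x \<le> n}"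
proof (induction n)
  case 0
  have "{x \<in> carrier G. len x \<le> 0} \<subseteq> {\<one>}" using len_eq_0 by auto
  then show ?case using finite_subset by blast
next
  case (Suc n)
  let ?B = "{x \<in> carrier G. len x \<le> n}" and ?U = "{x \<in> carrier G. len x = 1}"
  have "{x \<in> carrier G. len x \<le> Suc n} \<subseteq> ?B \<union> (\<lambda>(y, s). y \<otimes> s) ` (?B \<times> ?U)"
  proof
    fix x assume x: "x \<in> {x \<in> carrier G. len x \<le> Suc n}"
    show "x \<in> ?B \<union> (\<lambda>(y, s). y \<otimes> s) ` (?B \<times> ?U)"
    proof (cases "len x \<le> n")
      case False
      then have "len x = Suc n" using x by simp
      then obtain y s where "y \<in> carrier G" "s \<in> carrier G" "x = y \<otimes> s" "len y = n" "len s = 1"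
        using len_split x by blast
      then show ?thesis by force
    qed (use x in auto)
  qed
  then show ?case using Suc finite_unit by (meson finite_SigmaI finite_UnI finite_imageI finite_subset)
qed

lemma geodesic_from_one:
  assumes "x \<in> carrier G"
  obtains q where "q 0 = \<one>" "q (len x) = x" "\<And>i. q i \<in> carrier G"
    "\<And>i j. i \<le> len x \<Longrightarrow> j \<le> len x \<Longrightarrow> gdist (q i) (q j) = \<bar>real i - real j\<bar>"
proof -
  have "\<exists>q. q 0 = \<one> \<and> q n = x \<and> (\<forall>i. q i \<in> carrier G) \<and> (\<forall>i<n. gdist (q i) (q (Suc i)) \<le> 1)"
    if "x \<in> carrier G" "len x = n" for n x
    using that
  proof (induction n arbitrary: x)
    case 0
    then show ?case using len_eq_0 by (intro exI[of _ "\<lambda>_. \<one>"]) auto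
  next
    case (Suc n)
    obtain y s where ys: "y \<in> carrier G" "s \<in> carrier G" "x = y \<otimes> s" "len y = n" "len s = 1"
      using len_split Suc.prems by blast
    obtain q where q: "q 0 = \<one>" "q n = y" "\<forall>i. q i \<in> carrier G" "\<forall>i<n. gdist (q i) (q (Suc i)) \<le> 1"
      using Suc.IH[OF ys(1,4)] by blast
    have "gdist y x = 1" using ys gdist_mult_right by simp
    then show ?case using q Suc.prems(1)
      by (intro exI[of _ "q(Suc n := x)"]) (auto simp: less_Suc_eq)
  qed
  from this[OF assms refl] obtain q where q: "q 0 = \<one>" "q (len x) = x" "\<And>i. q i \<in> carrier G"
      "\<And>i. i < len x \<Longrightarrow> gdist (q i) (q (Suc i)) \<le> 1" by blast
  have up: "gdist (q i) (q (i + k)) \<le> real k" if "i + k \<le> len x" for i k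
    using that
  proof (induction k)
    case (Suc k)
    then show ?case using gdist_triangle[of "q i" "q (i + k)" "q (i + Suc k)"] q(3) q(4)[of "i + k"] by simp
  qed (use q gdist_self in auto)
  have eq: "gdist (q i) (q j) = real (j - i)" if "i \<le> j" "j \<le> len x" for i j
  proof -
    have "gdist (q 0) (q (len x)) = real (len x)" using q assms gdist_one by simp
    moreover have "gdist (q 0) (q (len x)) \<le> gdist (q 0) (q i) + gdist (q i) (q (len x))"
      "gdist (q i) (q (len x)) \<le> gdist (q i) (q j) + gdist (q j) (q (len x))"
      using gdist_triangle q(3) by blast+
    ultimately show ?thesis
      using up[of 0 i] up[of i "j - i"] up[of j "len x - j"] that by simp
  qed
  have "gdist (q i) (q j) = \<bar>real i - real j\<bar>" if "i \<le> len x" "j \<le> len x" for i j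
    using eq[of i j] eq[of j i] gdist_sym[of "q i" "q j"] q(3) that by (cases "i \<le> j") auto
  with q that show ?thesis by blast
qed

end

text \<open>Two such lengths are comparable because each of them is bounded on the finite unit sphere of the other.\<close>

lemma length_function_Lipschitz:
  assumes "length_function G len" "length_function G len'"
  obtains \<kappa> where "\<kappa> \<ge> 1" "\<And>x. x \<in> carrier G \<Longrightarrow> len' x \<le> \<kappa> * len x"
proof -
  interpret A: length_function G len by fact
  interpret B: length_function G len' by fact
  define \<kappa> where "\<kappa> = Max (insert 1 (len' ` {x \<in> carrier G. len x = 1}))"
  have fin: "finite (insert 1 (len' ` {x \<in> carrier G. len x = 1}))" using A.finite_unit by simp
  have "1 \<le> \<kappa>" unfolding \<kappa>_def using fin by (rule Max_ge) simp
  have unit: "len' s \<le> \<kappa>" if "s \<in> carrier G" "len s = 1" for s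
    unfolding \<kappa>_def using fin that by (intro Max_ge) auto
  have "len' x \<le> \<kappa> * n" if "x \<in> carrier G" "len x = n" for x n
    using that
  proof (induction n arbitrary: x)
    case 0
    then show ?case using A.len_eq_0 by simp
  next
    case (Suc n)
    obtain y s where ys: "y \<in> carrier G" "s \<in> carrier G" "x = y \<otimes>\<^bsub>G\<^esub> s" "len y = n" "len s = 1"
      using A.len_split Suc.prems by blast
    then have "len' x \<le> len' y + len' s" using B.len_mult by simp
    also have "\<dots> \<le> \<kappa> * n + \<kappa>" using ys Suc.IH unit add_mono by blast
    finally show ?case by simp
  qed
  with \<open>1 \<le> \<kappa>\<close> that show ?thesis by blast
qed

definition (in monoid) word_value :: "'a list \<Rightarrow> 'a" where
  "word_value ws = foldr (\<lambda>s y. s \<otimes> y) ws \<one>"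

lemma (in monoid) word_value_closed: "set ws \<subseteq> carrier G \<Longrightarrow> word_value ws \<in> carrier G"
  by (induction ws) (auto simp: word_value_def)

lemma (in monoid) word_value_append:
  "set us \<subseteq> carrier G \<Longrightarrow> set vs \<subseteq> carrier G \<Longrightarrow> word_value (us @ vs) = word_value us \<otimes> word_value vs"
proof (induction us)
  case Nil
  then show ?case using word_value_closed by (simp add: word_value_def)
next
  case (Cons a us)
  then show ?case using word_value_closed[of us] word_value_closed[of vs]
    by (simp add: word_value_def m_assoc)
qed

lemma (in monoid) word_value_single: "s \<in> carrier G \<Longrightarrow> word_value [s] = s"
  by (simp add: word_value_def)

lemma length_function_word_length:
  assumes "group G" and S: "finite_symmetric_generating_set G S"
  shows "length_function G (word_length G S)"
proof -
  interpret group G by fact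
  have fin: "finite S" and SG: "S \<subseteq> carrier G" and Sinv: "\<And>s. s \<in> S \<Longrightarrow> inv\<^bsub>G\<^esub> s \<in> S"
    and gen: "generate G S = carrier G"
    using S by (auto simp: finite_symmetric_generating_set_def)
  let ?l = "word_length G S"
  have l_def: "?l x = (LEAST k. \<exists>ws. length ws = k \<and> set ws \<subseteq> S \<and> word_value ws = x)" for x
    by (simp add: word_length_def word_value_def)
  have ex: "\<exists>ws. set ws \<subseteq> S \<and> word_value ws = x" if "x \<in> generate G S" for x
    using that
  proof induction
    case one
    then show ?case by (intro exI[of _ "[]"]) (simp add: word_value_def)
  next
    case (incl h)
    then show ?case using word_value_single SG by (intro exI[of _ "[h]"]) auto
  next
    case (inv h)
    then show ?case using word_value_single SG Sinv by (intro exI[of _ "[inv\<^bsub>G\<^esub> h]"]) auto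
  next
    case (eng h1 h2)
    then obtain us vs where "set us \<subseteq> S" "word_value us = h1" "set vs \<subseteq> S" "word_value vs = h2" by blast
    then show ?case using SG word_value_append by (intro exI[of _ "us @ vs"]) auto
  qed
  have le: "?l (word_value ws) \<le> length ws" if "set ws \<subseteq> S" for ws
    unfolding l_def by (rule Least_le) (use that in blast)
  have attained: "\<exists>ws. length ws = ?l x \<and> set ws \<subseteq> S \<and> word_value ws = x" if "x \<in> carrier G" for x
    unfolding l_def by (rule LeastI_ex) (use ex that gen in blast)
  have mult: "?l (x \<otimes>\<^bsub>G\<^esub> y) \<le> ?l x + ?l y" if xy: "x \<in> carrier G" "y \<in> carrier G" for x y
  proof -
    obtain us where "length us = ?l x" "set us \<subseteq> S" "word_value us = x"
      using attained[OF xy(1)] by blast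
    moreover obtain vs where "length vs = ?l y" "set vs \<subseteq> S" "word_value vs = y"
      using attained[OF xy(2)] by blast
    ultimately show ?thesis using le[of "us @ vs"] word_value_append SG by simp
  qed
  have inv_le: "?l (inv\<^bsub>G\<^esub> x) \<le> ?l x" if x: "x \<in> carrier G" for x
  proof -
    have "?l (inv\<^bsub>G\<^esub> (word_value ws)) \<le> length ws" if "set ws \<subseteq> S" for ws
      using that
    proof (induction ws)
      case Nil
      then show ?case using le[of "[]"] by (simp add: word_value_def)
    next
      case (Cons s ws)
      have c: "s \<in> carrier G" "word_value ws \<in> carrier G"
        using Cons.prems SG by (auto intro!: word_value_closed)
      have "inv\<^bsub>G\<^esub> (word_value (s # ws)) = inv\<^bsub>G\<^esub> (word_value ws) \<otimes>\<^bsub>G\<^esub> inv\<^bsub>G\<^esub> s"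
        using c by (simp add: word_value_def inv_mult_group)
      moreover have "?l (inv\<^bsub>G\<^esub> s) \<le> 1"
        using le[of "[inv\<^bsub>G\<^esub> s]"] Sinv Cons.prems c word_value_single by simp
      ultimately show ?case using mult[of "inv\<^bsub>G\<^esub> (word_value ws)" "inv\<^bsub>G\<^esub> s"] c Cons by simp
    qed
    moreover obtain ws where "length ws = ?l x" "set ws \<subseteq> S" "word_value ws = x"
      using attained[OF x] by blast
    ultimately show ?thesis by fastforce
  qed
  show ?thesis
  proof
    show "?l x = 0 \<longleftrightarrow> x = \<one>\<^bsub>G\<^esub>" if "x \<in> carrier G" for x
      using attained[OF that] le[of "[]"] by (auto simp: word_value_def)
    show "?l (inv\<^bsub>G\<^esub> x) = ?l x" if "x \<in> carrier G" for x
      using inv_le[OF that] inv_le[of "inv\<^bsub>G\<^esub> x"] that by simp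
    show "?l (x \<otimes>\<^bsub>G\<^esub> y) \<le> ?l x + ?l y" if "x \<in> carrier G" "y \<in> carrier G" for x y
      using mult that .
    show "\<exists>y\<in>carrier G. \<exists>s\<in>carrier G. x = y \<otimes>\<^bsub>G\<^esub> s \<and> ?l y = k \<and> ?l s = 1"
      if x: "x \<in> carrier G" and k: "?l x = Suc k" for x k
    proof -
      obtain ws where ws: "length ws = Suc k" "set ws \<subseteq> S" "word_value ws = x" using attained[OF x] k by auto
      then obtain us s where us: "ws = us @ [s]" by (metis length_Suc_conv_rev)
      have c: "set us \<subseteq> S" "s \<in> S" "s \<in> carrier G" "word_value us \<in> carrier G"
        using us ws SG by (auto intro!: word_value_closed)
      have xs: "x = word_value us \<otimes>\<^bsub>G\<^esub> s" using ws us c SG word_value_append[of us "[s]"] word_value_single by auto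
      have "?l (word_value us) \<le> k" "?l s \<le> 1"
        using le[of us] le[of "[s]"] word_value_single c us ws by auto
      moreover have "Suc k \<le> ?l (word_value us) + ?l s" using mult c xs k by metis
      ultimately show ?thesis using c xs by (intro bexI[of _ "word_value us"] bexI[of _ s]) auto
    qed
    show "finite {x \<in> carrier G. ?l x = 1}"
    proof (rule finite_subset[OF _ fin])
      show "{x \<in> carrier G. ?l x = 1} \<subseteq> S"
      proof clarify
        fix x assume "x \<in> carrier G" "?l x = 1"
        then obtain ws where "length ws = 1" "set ws \<subseteq> S" "word_value ws = x" using attained by fastforce
        then show "x \<in> S" using SG word_value_single by (cases ws) auto
      qed
    qed
  qed
qed

text \<open>The definition of virtual cyclicity speaks of the group generated by a subgroup; for a cyclic subgroup this
  is the same as the group generated by its generator.\<close>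

lemma (in group) virtually_cyclic_if_finite_index:
  assumes "u \<in> carrier G" "finite (rcosets (generate G {u}))"
  shows "virtually_cyclic G"
proof -
  let ?H = "generate G {u}"
  have H: "subgroup ?H G" using assms generate_is_subgroup by simp
  have "generate G (carrier G \<inter> ?H) = ?H"
    using H generate_subgroup_incl[OF _ H, of "carrier G \<inter> ?H"] subgroup.subset[OF H]
    by (auto intro: generate.incl)
  then have "subgroup_generated G ?H = subgroup_generated G {u}"
    using assms by (simp add: subgroup_generated_def)
  then have "cyclic_group (subgroup_generated G ?H)" by (simp add: cyclic_group_generated)
  with H assms show ?thesis unfolding virtually_cyclic_def by blast
qed

section \<open>Several word lengths along a common geodesic\<close>

text \<open>All lengths, the base length included, are treated as one family, since the arguments below control them
  simultaneously; \<open>b\<close> is the index of the base length.\<close>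

locale hyperbolic_lengths = group G for G :: "('a, 'b) monoid_scheme" (structure) +
  fixes L :: "'m::finite \<Rightarrow> 'a \<Rightarrow> nat" and b :: 'm and \<delta> :: real
  assumes lengths: "length_function G (L j)"
    and hyperbolic: "hyperbolic_distance (carrier G) (left_metric G (L b)) \<delta>"

sublocale hyperbolic_lengths \<subseteq> len: length_function G "L j" for j
  by (rule lengths)

sublocale hyperbolic_lengths \<subseteq> base: hyperbolic_distance "carrier G" "left_metric G (L b)" \<delta>
  by (rule hyperbolic)

context hyperbolic_lengths
begin

abbreviation d :: "'m \<Rightarrow> 'a \<Rightarrow> 'a \<Rightarrow> real" where
  "d j \<equiv> left_metric G (L j)"

abbreviation gp :: "'a \<Rightarrow> 'a \<Rightarrow> 'a \<Rightarrow> real" where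
  "gp \<equiv> base.gp"

lemma gp_translate: "g \<in> carrier G \<Longrightarrow> w \<in> carrier G \<Longrightarrow> x \<in> carrier G \<Longrightarrow> y \<in> carrier G \<Longrightarrow>
    gp (g \<otimes> w) (g \<otimes> x) (g \<otimes> y) = gp w x y"
  by (simp add: gromov_product_def len.gdist_translate)

lemma gp_one_at: "x \<in> carrier G \<Longrightarrow> w \<in> carrier G \<Longrightarrow>
    gp x \<one> (x \<otimes> w) = (real (L b x) + real (L b w) - real (L b (x \<otimes> w))) / 2"
  using len.gdist_sym[of x "x \<otimes> w"] len.gdist_mult_right[of x w]
  by (simp add: gromov_product_def len.gdist_one)

lemma common_Lipschitz:
  obtains \<kappa> :: nat where "\<kappa> \<ge> 1" "\<And>i j x. x \<in> carrier G \<Longrightarrow> L i x \<le> \<kappa> * L j x"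
proof -
  have "\<forall>i j. \<exists>\<kappa>. \<forall>x\<in>carrier G. L i x \<le> \<kappa> * L j x"
    using length_function_Lipschitz[OF lengths lengths] by metis
  then obtain f where f: "\<And>i j x. x \<in> carrier G \<Longrightarrow> L i x \<le> f i j * L j x"
    by metis
  define \<kappa> where "\<kappa> = Max (insert 1 (range (\<lambda>(i, j). f i j)))"
  have "f i j \<le> \<kappa>" for i j
    unfolding \<kappa>_def by (intro Max_ge) auto
  then have "L i x \<le> \<kappa> * L j x" if "x \<in> carrier G" for i j x
    using f[OF that, of i j] by (meson le_trans mult_le_mono1)
  moreover have "1 \<le> \<kappa>" unfolding \<kappa>_def by (intro Max_ge) auto
  ultimately show ?thesis using that by blast
qed

text \<open>If \<open>x\<close> nearly lies on a base geodesic from \<open>\<one>\<close> to \<open>w\<close>, then every geodesic for another length passes within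
  bounded base distance of \<open>x\<close>, because it is a quasi-geodesic for the base metric.  The equation says that
  \<open>x \<otimes> g\<close> lies on such a geodesic.\<close>

lemma geodesics_fellow_travel_single:
  obtains K :: nat where "\<And>x w. x \<in> carrier G \<Longrightarrow> w \<in> carrier G \<Longrightarrow> gp x \<one> w \<le> c \<Longrightarrow>
    \<exists>g\<in>carrier G. L b g \<le> K \<and> L j (x \<otimes> g) + L j (inv (x \<otimes> g) \<otimes> w) = L j w"
proof -
  obtain \<kappa> :: nat where \<kappa>: "\<kappa> \<ge> 1" "\<And>i j x. x \<in> carrier G \<Longrightarrow> L i x \<le> \<kappa> * L j x"
    using common_Lipschitz by blast
  have \<kappa>1: "1 \<le> real \<kappa>" using \<kappa>(1) by simp
  obtain D0 where D0: "\<And>l q n p t. base.geodesic_upto l 1 q \<Longrightarrow> base.quasigeodesic_upto n (real \<kappa>) p \<Longrightarrow>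
      p 0 = q 0 \<Longrightarrow> p n = q l \<Longrightarrow> t \<le> l \<Longrightarrow> \<exists>i\<le>n. d b (q t) (p i) \<le> D0"
    using base.geodesic_near_quasigeodesic[OF \<kappa>1] by blast
  define K where "K = nat \<lceil>c + 2 * \<delta> + 1 + D0\<rceil>"
  show ?thesis
  proof (rule that[of K])
    fix x w assume x: "x \<in> carrier G" and w: "w \<in> carrier G" and c: "gp x \<one> w \<le> c"
    obtain q where q: "q 0 = \<one>" "q (L b w) = w" "\<And>i. q i \<in> carrier G"
      "\<And>i j. i \<le> L b w \<Longrightarrow> j \<le> L b w \<Longrightarrow> d b (q i) (q j) = \<bar>real i - real j\<bar>"
      using len.geodesic_from_one[OF w] by blast
    obtain p where p: "p 0 = \<one>" "p (L j w) = w" "\<And>i. p i \<in> carrier G"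
      "\<And>i k. i \<le> L j w \<Longrightarrow> k \<le> L j w \<Longrightarrow> d j (p i) (p k) = \<bar>real i - real k\<bar>"
      using len.geodesic_from_one[OF w] by blast
    have geo: "base.geodesic_upto (L b w) 1 q"
      using q by (auto simp: base.geodesic_upto_def)
    obtain t where t: "t \<le> L b w" "d b x (q t) \<le> c + 2 * \<delta> + 1"
      using base.near_geodesic[OF geo _ x] c q by auto
    have dL: "d i y z \<le> real \<kappa> * d k y z" if "y \<in> carrier G" "z \<in> carrier G" for i k y z
      using \<kappa>(2)[of "inv y \<otimes> z" i k] that by (simp add: left_metric_def flip: of_nat_mult)
    have quasi: "base.quasigeodesic_upto (L j w) (real \<kappa>) p"
      unfolding base.quasigeodesic_upto_def
    proof (intro conjI allI impI)
      show "d b (p i) (p (Suc i)) \<le> real \<kappa>" if "i < L j w" for i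
        using dL[of "p i" "p (Suc i)" b j] p that by simp
      show "\<bar>real i - real k\<bar> \<le> real \<kappa> * d b (p i) (p k)" if "i \<le> L j w" "k \<le> L j w" for i k
        using dL[of "p i" "p k" j b] p that by simp
    qed (use p in auto)
    have "\<exists>i\<le>L j w. d b (q t) (p i) \<le> D0"
      by (rule D0[OF geo quasi]) (use p q t in auto)
    then obtain i where i: "i \<le> L j w" "d b (q t) (p i) \<le> D0" by blast
    define g where "g = inv x \<otimes> p i"
    have g: "g \<in> carrier G" "x \<otimes> g = p i" using x p mult_inv_cancel by (auto simp: g_def)
    have "real (L b g) = d b x (p i)" by (simp add: g_def left_metric_def)
    also have "\<dots> \<le> d b x (q t) + d b (q t) (p i)" using len.gdist_triangle x p q by blast
    also have "\<dots> \<le> c + 2 * \<delta> + 1 + D0" using t i by linarith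
    finally have "L b g \<le> K" by (simp add: K_def) linarith
    moreover have "real (L j (p i)) = real i" "real (L j (inv (p i) \<otimes> w)) = real (L j w - i)"
      using p(4)[of 0 i] p(4)[of i "L j w"] i p(1,2,3) len.gdist_one[of "p i" j]
      by (auto simp: left_metric_def)
    ultimately show "\<exists>g\<in>carrier G. L b g \<le> K \<and> L j (x \<otimes> g) + L j (inv (x \<otimes> g) \<otimes> w) = L j w"
      using g i by (intro bexI[of _ g]) auto
  qed
qed

lemma geodesics_fellow_travel:
  obtains K :: nat where "\<And>j x w. x \<in> carrier G \<Longrightarrow> w \<in> carrier G \<Longrightarrow> gp x \<one> w \<le> c \<Longrightarrow>
    \<exists>g\<in>carrier G. L b g \<le> K \<and> L j (x \<otimes> g) + L j (inv (x \<otimes> g) \<otimes> w) = L j w"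
proof -
  have "\<forall>j. \<exists>K. \<forall>x\<in>carrier G. \<forall>w\<in>carrier G. gp x \<one> w \<le> c \<longrightarrow>
    (\<exists>g\<in>carrier G. L b g \<le> K \<and> L j (x \<otimes> g) + L j (inv (x \<otimes> g) \<otimes> w) = L j w)"
    using geodesics_fellow_travel_single by metis
  then obtain k where k: "\<And>j x w. x \<in> carrier G \<Longrightarrow> w \<in> carrier G \<Longrightarrow> gp x \<one> w \<le> c \<Longrightarrow>
    \<exists>g\<in>carrier G. L b g \<le> k j \<and> L j (x \<otimes> g) + L j (inv (x \<otimes> g) \<otimes> w) = L j w"
    by metis
  have "k j \<le> Max (range k)" for j by simp
  with k show ?thesis by (intro that[of "Max (range k)"]) (meson le_trans)
qed

text \<open>Absence of backtracking is measured in the base metric alone, but it makes all lengths additive up to a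
  constant: split a geodesic of each length at its point near \<open>x\<close>.\<close>

lemma lengths_nearly_additive:
  obtains C :: nat where "\<And>j x w. x \<in> carrier G \<Longrightarrow> w \<in> carrier G \<Longrightarrow> gp x \<one> (x \<otimes> w) \<le> c \<Longrightarrow>
    L j x + L j w \<le> L j (x \<otimes> w) + C"
proof -
  obtain K where K: "\<And>j x w. x \<in> carrier G \<Longrightarrow> w \<in> carrier G \<Longrightarrow> gp x \<one> w \<le> c \<Longrightarrow>
    \<exists>g\<in>carrier G. L b g \<le> K \<and> L j (x \<otimes> g) + L j (inv (x \<otimes> g) \<otimes> w) = L j w"
    using geodesics_fellow_travel by blast
  obtain \<kappa> :: nat where \<kappa>: "\<kappa> \<ge> 1" "\<And>i j x. x \<in> carrier G \<Longrightarrow> L i x \<le> \<kappa> * L j x"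
    using common_Lipschitz by blast
  show ?thesis
  proof (rule that[of "2 * (\<kappa> * K)"])
    fix j x w assume x: "x \<in> carrier G" and w: "w \<in> carrier G" and c: "gp x \<one> (x \<otimes> w) \<le> c"
    obtain g where g: "g \<in> carrier G" "L b g \<le> K"
      "L j (x \<otimes> g) + L j (inv (x \<otimes> g) \<otimes> (x \<otimes> w)) = L j (x \<otimes> w)" using K x w c by blast
    have gK: "L j g \<le> \<kappa> * K" using \<kappa>(2)[OF g(1), of j b] g(2) by (meson le_trans mult_le_mono2)
    have "L j x \<le> L j (x \<otimes> g) + L j g"
      using len.len_mult[of "x \<otimes> g" "inv g" j] x g(1) len.len_inv by (simp add: m_assoc)
    moreover have "L j w \<le> L j g + L j (inv g \<otimes> w)"
      using len.len_mult[of g "inv g \<otimes> w" j] g(1) w mult_inv_cancel by simp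
    moreover have "inv (x \<otimes> g) \<otimes> (x \<otimes> w) = inv g \<otimes> w" using inv_mult_cancel x g w by simp
    ultimately show "L j x + L j w \<le> L j (x \<otimes> w) + 2 * (\<kappa> * K)" using g(3) gK by simp
  qed
qed

section \<open>Pumping along geodesics\<close>

text \<open>This is Cannon's local type of \<open>x\<close>, recorded for all the lengths at once.  Outside the ball the value is
  \<open>0\<close> by convention, which makes the set of types finite.\<close>

definition local_type :: "nat \<Rightarrow> 'a \<Rightarrow> 'a \<times> 'm \<Rightarrow> int" where
  "local_type K x = (\<lambda>(g, j). if g \<in> carrier G \<and> L b g \<le> K
     then int (L j (x \<otimes> g)) - int (L j x) else 0)"

lemma length_increment_le:
  assumes "x \<in> carrier G" "u \<in> carrier G"
  shows "\<bar>int (L j (x \<otimes> u)) - int (L j x)\<bar> \<le> int (L j u)"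
proof -
  have "L j (x \<otimes> u) \<le> L j x + L j u" using assms len.len_mult by blast
  moreover have "L j x \<le> L j (x \<otimes> u) + L j u"
    using len.len_mult[of "x \<otimes> u" "inv u" j] assms len.len_inv by (simp add: m_assoc)
  ultimately show ?thesis by linarith
qed

lemma finite_local_types: "finite (local_type K ` carrier G)"
proof -
  obtain \<kappa> :: nat where \<kappa>: "\<kappa> \<ge> 1" "\<And>i j x. x \<in> carrier G \<Longrightarrow> L i x \<le> \<kappa> * L j x"
    using common_Lipschitz by blast
  let ?A = "{g \<in> carrier G. L b g \<le> K} \<times> (UNIV :: 'm set)" and ?B = "{- int (\<kappa> * K)..int (\<kappa> * K)}"
  have "local_type K ` carrier G \<subseteq> {f. \<forall>z. (z \<in> ?A \<longrightarrow> f z \<in> ?B) \<and> (z \<notin> ?A \<longrightarrow> f z = 0)}"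
  proof clarsimp
    fix x g j assume x: "x \<in> carrier G"
    have "\<bar>int (L j (x \<otimes> g)) - int (L j x)\<bar> \<le> int (\<kappa> * K)" if "g \<in> carrier G" "L b g \<le> K"
    proof -
      have "L j g \<le> \<kappa> * K" using \<kappa>(2)[OF that(1), of j b] that(2) by (meson le_trans mult_le_mono2)
      then show ?thesis using length_increment_le[OF x that(1), of j] by linarith
    qed
    then show "(g \<in> carrier G \<and> L b g \<le> K \<longrightarrow> - (int \<kappa> * int K) \<le> local_type K x (g, j) \<and>
        local_type K x (g, j) \<le> int \<kappa> * int K) \<and>
        ((g \<in> carrier G \<longrightarrow> \<not> L b g \<le> K) \<longrightarrow> local_type K x (g, j) = 0)"
      by (auto simp: local_type_def abs_le_iff)
  qed
  moreover have "finite {f. \<forall>z. (z \<in> ?A \<longrightarrow> f z \<in> ?B) \<and> (z \<notin> ?A \<longrightarrow> f z = (0::int))}"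
    by (intro finite_set_of_finite_funs finite_cartesian_product len.finite_ball) auto
  ultimately show ?thesis by (rule finite_subset)
qed

text \<open>The bound \<open>1\<close> on the Gromov product leaves room for an extension by one letter that is not yet known to be
  geodesic.\<close>

definition fellow_travel_constant :: "nat \<Rightarrow> bool" where
  "fellow_travel_constant K \<longleftrightarrow> (\<forall>j. \<forall>x\<in>carrier G. \<forall>w\<in>carrier G. gp x \<one> w \<le> 1 \<longrightarrow>
     (\<exists>g\<in>carrier G. L b g \<le> K \<and> L j (x \<otimes> g) + L j (inv (x \<otimes> g) \<otimes> w) = L j w))"

lemma ex_fellow_travel_constant: "\<exists>K. fellow_travel_constant K"
  using geodesics_fellow_travel[of 1] unfolding fellow_travel_constant_def by metis

text \<open>Split a \<open>j\<close>-geodesic from \<open>\<one>\<close> to \<open>x' \<otimes> w\<close> at its point \<open>x' \<otimes> g\<close> near \<open>x'\<close>.  The length of \<open>x \<otimes> g\<close> is known from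
  the type, and the remaining part of the geodesic can be translated to start at \<open>x \<otimes> g\<close>.\<close>

lemma extension_increment_le:
  assumes K: "fellow_travel_constant K" and eq: "local_type K x = local_type K x'"
    and G: "x \<in> carrier G" "x' \<in> carrier G" "w \<in> carrier G"
    and near: "gp x' \<one> (x' \<otimes> w) \<le> 1"
  shows "int (L j (x \<otimes> w)) - int (L j x) \<le> int (L j (x' \<otimes> w)) - int (L j x')"
proof -
  obtain g where g: "g \<in> carrier G" "L b g \<le> K"
    "L j (x' \<otimes> g) + L j (inv (x' \<otimes> g) \<otimes> (x' \<otimes> w)) = L j (x' \<otimes> w)"
    using K near G unfolding fellow_travel_constant_def by blast
  have w: "inv (x' \<otimes> g) \<otimes> (x' \<otimes> w) = inv g \<otimes> w" using inv_mult_cancel G g by simp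
  have "x \<otimes> w = (x \<otimes> g) \<otimes> (inv g \<otimes> w)"
    using G g by (simp add: m_assoc mult_inv_cancel)
  then have "L j (x \<otimes> w) \<le> L j (x \<otimes> g) + L j (inv g \<otimes> w)"
    using len.len_mult G g by simp
  moreover have "int (L j (x \<otimes> g)) - int (L j x) = int (L j (x' \<otimes> g)) - int (L j x')"
    using fun_cong[OF eq, of "(g, j)"] g by (simp add: local_type_def)
  ultimately show ?thesis using g(3) w by simp
qed

text \<open>By symmetry, \<open>extension_increment_le\<close> yields equality as soon as both \<open>x \<otimes> w\<close> and \<open>x' \<otimes> w\<close> are nearly
  geodesic extensions.  For \<open>x'\<close> this is not assumed; it follows by induction along \<open>w\<close>, since
  equality of the base increments for a word carries geodesicity over to \<open>x'\<close>, and one further letter changes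
  the Gromov product by at most \<open>1\<close>.\<close>

lemma local_type_determines_extensions:
  assumes K: "fellow_travel_constant K" and eq: "local_type K x = local_type K x'"
    and G: "x \<in> carrier G" "x' \<in> carrier G" "w \<in> carrier G"
    and geo: "L b (x \<otimes> w) = L b x + L b w"
  shows "int (L j (x' \<otimes> w)) - int (L j x') = int (L j (x \<otimes> w)) - int (L j x)"
proof -
  have "\<forall>j. int (L j (x' \<otimes> w)) - int (L j x') = int (L j (x \<otimes> w)) - int (L j x)"
    if "w \<in> carrier G" "L b w = n" "L b (x \<otimes> w) = L b x + L b w" for n w
    using that
  proof (induction n arbitrary: w)
    case 0
    then show ?case using len.len_eq_0 G by simp
  next
    case (Suc n)
    obtain y s where ys: "y \<in> carrier G" "s \<in> carrier G" "w = y \<otimes> s" "L b y = n" "L b s = 1"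
      using len.len_split Suc.prems by blast
    have w: "w \<in> carrier G" using ys by simp
    have xw: "x \<otimes> w = (x \<otimes> y) \<otimes> s" "x' \<otimes> w = (x' \<otimes> y) \<otimes> s" using ys G by (simp_all add: m_assoc)
    have "L b (x \<otimes> w) \<le> L b (x \<otimes> y) + 1" using len.len_mult[of "x \<otimes> y" s b] xw G ys by simp
    moreover have "L b (x \<otimes> y) \<le> L b x + L b y" using len.len_mult G ys by blast
    ultimately have "L b (x \<otimes> y) = L b x + L b y" using Suc.prems ys by simp
    then have "int (L b (x' \<otimes> y)) - int (L b x') = int (L b (x \<otimes> y)) - int (L b x)"
      using Suc.IH ys by blast
    then have "L b (x' \<otimes> y) = L b x' + n" using \<open>L b (x \<otimes> y) = L b x + L b y\<close> ys by simp
    moreover have "int (L b (x' \<otimes> y)) - int (L b s) \<le> int (L b (x' \<otimes> w))"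
      using length_increment_le[of "x' \<otimes> y" s b] xw G ys by simp
    ultimately have "L b x' + L b w \<le> L b (x' \<otimes> w) + 2" using ys Suc.prems by simp
    then have "gp x' \<one> (x' \<otimes> w) \<le> 1" using gp_one_at[of x' w] G w by simp
    moreover have "gp x \<one> (x \<otimes> w) \<le> 1" using gp_one_at[of x w] G w Suc.prems by simp
    ultimately show ?case
      using extension_increment_le[OF K eq G(1,2) w] extension_increment_le[OF K eq[symmetric] G(2,1) w]
      by (intro allI antisym)
  qed
  with G geo show ?thesis by blast
qed

text \<open>Comparing the types of \<open>x\<close> and \<open>x \<otimes> u\<close> suffices for all powers: the word \<open>u\<^sup>p\<close> is a geodesic extension of \<open>x\<close> by
  the induction hypothesis, and equality of the types of \<open>x\<close> and \<open>x \<otimes> u\<close> transfers its increments to \<open>x \<otimes> u\<close>.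
  The second conclusion says that the powers of \<open>u\<close> form a base geodesic.\<close>

lemma pumping:
  assumes K: "fellow_travel_constant K" and G: "x \<in> carrier G" "u \<in> carrier G"
    and eq: "local_type K x = local_type K (x \<otimes> u)"
    and geo: "L b (x \<otimes> u) = L b x + L b u"
  shows "(\<forall>j. int (L j (x \<otimes> u [^] p)) = int (L j x) + int p * (int (L j (x \<otimes> u)) - int (L j x)))
    \<and> L b (u [^] p) = p * L b u"
proof (induction p)
  case 0
  then show ?case using G by simp
next
  case (Suc p)
  have up: "u [^] p \<in> carrier G" using G by simp
  have pow: "x \<otimes> u [^] Suc p = (x \<otimes> u) \<otimes> u [^] p"
    using G up nat_pow_Suc2[of u p] by (simp add: m_assoc)
  have Lp: "L b (x \<otimes> u [^] p) = L b x + L b (u [^] p)"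
    using Suc geo by (simp flip: of_nat_eq_iff[where 'a = int])
  have "int (L j (x \<otimes> u [^] Suc p)) = int (L j x) + int (Suc p) * (int (L j (x \<otimes> u)) - int (L j x))" for j
    using local_type_determines_extensions[OF K eq G(1) _ up Lp, of j] Suc G pow
    by (simp add: algebra_simps)
  moreover from this[of b] have "L b (u [^] Suc p) = Suc p * L b u"
  proof -
    assume "int (L b (x \<otimes> u [^] Suc p)) = int (L b x) + int (Suc p) * (int (L b (x \<otimes> u)) - int (L b x))"
    then have "int (L b (x \<otimes> u [^] Suc p)) = int (L b x + Suc p * L b u)" using geo
      by (simp add: algebra_simps)
    then have "L b (x \<otimes> u [^] Suc p) = L b x + Suc p * L b u" by linarith
    moreover have "L b (x \<otimes> u [^] Suc p) \<le> L b x + L b (u [^] Suc p)"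
      using len.len_mult G by (metis nat_pow_closed)
    moreover have "L b (u [^] Suc p) \<le> L b (u [^] p) + L b u"
      using len.len_mult[OF up G(2)] by simp
    ultimately show ?thesis using Suc by simp
  qed
  ultimately show ?case by blast
qed

text \<open>The vector \<open>v\<close> collects the stable translation lengths of \<open>u\<close> for all the metrics.\<close>

definition translates :: "'a \<Rightarrow> ('m \<Rightarrow> real) \<Rightarrow> bool" where
  "translates u v \<longleftrightarrow> u \<in> carrier G \<and> 0 < L b u \<and> v b = real (L b u) \<and>
     (\<forall>p. L b (u [^] p) = p * L b u) \<and> (\<exists>C. \<forall>p j. \<bar>real (L j (u [^] p)) - real p * v j\<bar> \<le> C)"

lemma translates_pump:
  assumes K: "fellow_travel_constant K" and G: "x \<in> carrier G" "u \<in> carrier G" "0 < L b u"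
    and eq: "local_type K x = local_type K (x \<otimes> u)"
    and geo: "L b (x \<otimes> u) = L b x + L b u"
  shows "translates u (\<lambda>j. real_of_int (int (L j (x \<otimes> u)) - int (L j x)))"
proof -
  let ?v = "\<lambda>j. int (L j (x \<otimes> u)) - int (L j x)"
  note pump = pumping[OF K G(1,2) eq geo]
  have "\<bar>real (L j (u [^] p)) - real p * real_of_int (?v j)\<bar> \<le> 2 * real (Max (range (\<lambda>j. L j x)))" for p j
  proof -
    have up: "u [^] p \<in> carrier G" using G by simp
    have "L j (u [^] p) \<le> L j (inv x) + L j (x \<otimes> u [^] p)"
      using len.len_mult[of "inv x" "x \<otimes> u [^] p" j] G up inv_mult_cancel_left by simp
    then have "L j (u [^] p) \<le> L j x + L j (x \<otimes> u [^] p)" using len.len_inv G by simp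
    moreover have "L j (x \<otimes> u [^] p) \<le> L j x + L j (u [^] p)" using len.len_mult G up by blast
    moreover have "int (L j (x \<otimes> u [^] p)) = int (L j x) + int p * ?v j" using pump by blast
    ultimately have "\<bar>int (L j (u [^] p)) - int p * ?v j\<bar> \<le> int (2 * L j x)" by linarith
    then have "real_of_int \<bar>int (L j (u [^] p)) - int p * ?v j\<bar> \<le> real_of_int (int (2 * L j x))"
      by (simp only: of_int_le_iff)
    then have "\<bar>real (L j (u [^] p)) - real p * real_of_int (?v j)\<bar> \<le> 2 * real (L j x)" by simp
    moreover have "L j x \<le> Max (range (\<lambda>j. L j x))" by simp
    then have "real (L j x) \<le> real (Max (range (\<lambda>j. L j x)))" by (rule of_nat_mono)
    ultimately show ?thesis by linarith
  qed
  then show ?thesis using G pump geo unfolding translates_def by auto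
qed

text \<open>A base geodesic with at least as many steps as there are types contains two points of equal type.  Removing the
  segment between them subtracts its translation vector from the lengths, so induction on the base length
  writes all lengths of \<open>x\<close> as a sum of translation vectors, up to the lengths of a short element.\<close>

lemma lengths_decompose:
  assumes inf: "infinite (carrier G)"
  obtains V :: "('m \<Rightarrow> real) set" and C :: real where
    "finite V" "V \<noteq> {}" "\<And>v. v \<in> V \<Longrightarrow> \<exists>u. translates u v"
    "\<And>x. x \<in> carrier G \<Longrightarrow> \<exists>a :: ('m \<Rightarrow> real) \<Rightarrow> nat.
       \<forall>j. \<bar>real (L j x) - (\<Sum>v\<in>V. real (a v) * v j)\<bar> \<le> C"
proof -
  obtain K where K: "fellow_travel_constant K" using ex_fellow_travel_constant by blast
  obtain \<kappa> :: nat where \<kappa>: "\<kappa> \<ge> 1" "\<And>i j x. x \<in> carrier G \<Longrightarrow> L i x \<le> \<kappa> * L j x"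
    using common_Lipschitz by blast
  define N where "N = card (local_type K ` carrier G)"
  define M where "M = int (\<kappa> * N)"
  \<comment> \<open>Increments along at most \<open>N\<close> letters are integers bounded by \<open>M\<close>, which makes \<open>V\<close> finite.\<close>
  define V where "V = {v. (\<exists>u. translates u v) \<and> (\<forall>j. v j \<in> real_of_int ` {-M..M})}"
  have "finite (PiE (UNIV :: 'm set) (\<lambda>_. real_of_int ` {-M..M}))"
    by (intro finite_PiE) auto
  then have finV: "finite V"
    by (rule rev_finite_subset) (auto simp: V_def PiE_def)
  have cut: "\<exists>v\<in>V. \<exists>y\<in>carrier G. L b y < L b x \<and> (\<forall>j. real (L j x) = real (L j y) + v j)"
    if x: "x \<in> carrier G" and N: "N \<le> L b x" for x
  proof -
    obtain q where q: "q 0 = \<one>" "q (L b x) = x" "\<And>i. q i \<in> carrier G"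
      "\<And>i j. i \<le> L b x \<Longrightarrow> j \<le> L b x \<Longrightarrow> d b (q i) (q j) = \<bar>real i - real j\<bar>"
      using len.geodesic_from_one[OF x] by blast
    have "card ((\<lambda>i. local_type K (q i)) ` {..N}) \<le> N"
      unfolding N_def using finite_local_types q(3) by (intro card_mono) auto
    then have "\<not> inj_on (\<lambda>i. local_type K (q i)) {..N}" using card_image by fastforce
    then obtain i k where "i < k" "k \<le> N" and same: "local_type K (q i) = local_type K (q k)"
      by (auto simp: inj_on_def) (metis linorder_neqE_nat)
    define u where "u = inv (q i) \<otimes> q k"
    define w where "w = inv (q k) \<otimes> x"
    have G: "u \<in> carrier G" "w \<in> carrier G" "q i \<otimes> u = q k" "q k \<otimes> w = x"
      using q x mult_inv_cancel by (auto simp: u_def w_def)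
    have kx: "k \<le> L b x" using \<open>k \<le> N\<close> N by simp
    have ql: "L b (q r) = r" if "r \<le> L b x" for r
      using q(4)[of 0 r] q(1,3) len.gdist_one[of "q r" b] that by simp
    have Lu: "L b u = k - i" using q(4)[of i k] \<open>i < k\<close> kx by (simp add: u_def left_metric_def)
    have Lw: "L b w = L b x - k" using q(4)[of k "L b x"] q(2) kx by (simp add: w_def left_metric_def)
    define v where "v = (\<lambda>j. real_of_int (int (L j (q i \<otimes> u)) - int (L j (q i))))"
    have "translates u v" unfolding v_def
      using translates_pump[OF K q(3) G(1), of i] Lu same G ql[of i] ql[of k] kx \<open>i < k\<close> by simp
    moreover have "v j \<in> real_of_int ` {-M..M}" for j
    proof -
      have "L b u \<le> N" using Lu \<open>k \<le> N\<close> by simp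
      then have "L j u \<le> \<kappa> * N" using \<kappa>(2)[OF G(1), of j b] by (meson le_trans mult_le_mono2)
      then have "\<bar>int (L j (q i \<otimes> u)) - int (L j (q i))\<bar> \<le> M"
        using length_increment_le[OF q(3) G(1), of j i] by (simp only: M_def)
      then show ?thesis unfolding v_def by (intro imageI) auto
    qed
    ultimately have "v \<in> V" by (auto simp: V_def)
    define y where "y = q i \<otimes> w"
    have "L b (q k \<otimes> w) = L b (q k) + L b w" using G Lw ql kx by simp
    from local_type_determines_extensions[OF K same[symmetric] q(3) q(3) G(2) this]
    have inc: "int (L j y) - int (L j (q i)) = int (L j x) - int (L j (q k))" for j
      using G by (simp add: y_def)
    then have "real_of_int (int (L j x)) = real_of_int (int (L j y) + (int (L j (q k)) - int (L j (q i))))" for j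
      by (smt (verit))
    then have "\<forall>j. real (L j x) = real (L j y) + v j" using G(3) by (simp add: v_def)
    moreover have "L b y < L b x" using inc[of b] ql[of i] ql[of k] kx \<open>i < k\<close> by simp
    moreover have "y \<in> carrier G" using q G by (simp add: y_def)
    ultimately show ?thesis using \<open>v \<in> V\<close> by blast
  qed
  have "V \<noteq> {}"
  proof -
    have "carrier G \<noteq> {x \<in> carrier G. L b x \<le> N}" using inf len.finite_ball[of b N] by metis
    then obtain x where "x \<in> carrier G" "\<not> L b x \<le> N" by blast
    then have "x \<in> carrier G" "N \<le> L b x" by simp_all
    then show ?thesis using cut by blast
  qed
  have dec: "\<exists>a :: ('m \<Rightarrow> real) \<Rightarrow> nat. \<forall>j. \<bar>real (L j x) - (\<Sum>v\<in>V. real (a v) * v j)\<bar> \<le> real (\<kappa> * N)"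
    if "x \<in> carrier G" for x
    using that
  proof (induction "L b x" arbitrary: x rule: less_induct)
    case (less x)
    show ?case
    proof (cases "N \<le> L b x")
      case False
      have "L j x \<le> \<kappa> * N" for j using \<kappa>(2)[OF less.prems, of j b] False
        by (meson le_trans mult_le_mono2 nat_le_linear)
      then have "real (L j x) \<le> real (\<kappa> * N)" for j by (simp only: of_nat_le_iff)
      then show ?thesis by (intro exI[of _ "\<lambda>_. 0"]) simp
    next
      case True
      then obtain v y where v: "v \<in> V" "y \<in> carrier G" "L b y < L b x"
        "\<forall>j. real (L j x) = real (L j y) + v j" using cut less.prems by blast
      then obtain a :: "('m \<Rightarrow> real) \<Rightarrow> nat" where
        a: "\<forall>j. \<bar>real (L j y) - (\<Sum>v\<in>V. real (a v) * v j)\<bar> \<le> real (\<kappa> * N)"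
        using less.hyps by blast
      have "(\<Sum>v'\<in>V. real ((a(v := Suc (a v))) v') * v' j) = (\<Sum>v'\<in>V. real (a v') * v' j) + v j" for j
      proof -
        have "(\<Sum>v'\<in>V. real ((a(v := Suc (a v))) v') * v' j) =
            (\<Sum>v'\<in>V. real (a v') * v' j + (if v' = v then v j else 0))"
          by (intro sum.cong) (auto simp: algebra_simps)
        then show ?thesis using finV v(1) by (simp add: sum.distrib)
      qed
      then show ?thesis using a v(4) by (intro exI[of _ "a(v := Suc (a v))"]) simp
    qed
  qed
  show ?thesis
    by (rule that[OF finV \<open>V \<noteq> {}\<close>]) (use dec in \<open>auto simp: V_def\<close>)
qed

section \<open>Concatenating translations\<close>

lemma gp_change_base:
  assumes "w \<in> carrier G" "y \<in> carrier G" "x \<in> carrier G" "z \<in> carrier G"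
  shows "gp w x z - d b w y \<le> gp y x z"
  using len.gdist_triangle[of x y w b] len.gdist_triangle[of z y w b] assms len.gdist_sym[of w y b]
  by (simp add: gromov_product_def field_simps)

lemma gp_le: "x \<in> carrier G \<Longrightarrow> z \<in> carrier G \<Longrightarrow> gp \<one> x z \<le> real (L b x)"
  using len.gdist_triangle[of \<one> x z b] len.gdist_sym[of \<one> x b] len.gdist_sym[of \<one> z b]
  by (simp add: gromov_product_def len.gdist_one)

text \<open>The hypothesis says that every \<open>h\<close> takes the boundary point of the ray \<open>u\<^sup>q\<close> to that of the ray \<open>g\<^sup>p\<close>.  Then, for all
  large \<open>p\<close>, the point \<open>g\<^sup>p\<close> is uniformly close to some \<open>h \<otimes> u\<^sup>q\<close>.  Given more cosets of \<open>\<langle>u\<rangle>\<close> than there are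
  elements in the corresponding ball, choose one \<open>p\<close> that is large enough for representatives of all of
  them; two of the elements \<open>g\<^sup>-\<^sup>p h u\<^sup>q\<close> then coincide, and so do the two cosets.\<close>

lemma finite_index_if_powers_asymptotic:
  assumes g: "g \<in> carrier G" "\<And>p. L b (g [^] p) = p * L b g" "0 < L b g"
    and u: "u \<in> carrier G" "\<And>p. L b (u [^] p) = p * L b u" "0 < L b u"
    and unb: "\<And>h c. h \<in> carrier G \<Longrightarrow> \<exists>(p::nat) (q::nat). c < gp \<one> (g [^] p) (h \<otimes> u [^] q)"
  shows "finite (rcosets (generate G {u}))"
proof (rule ccontr)
  let ?H = "generate G {u}"
  assume inf: "infinite (rcosets ?H)"
  have H: "subgroup ?H G" using u generate_is_subgroup by simp
  have gpow: "g [^] p \<in> carrier G" and upow: "u [^] p \<in> carrier G" for p :: nat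
    using g u by auto
  define K where "K = nat \<lceil>4 * \<delta> + real (L b u)\<rceil>"
  define B where "B = {x \<in> carrier G. L b x \<le> K}"
  have finB: "finite B" unfolding B_def by (rule len.finite_ball)
  \<comment> \<open>Below, \<open>z\<close> is a far point on the ray of \<open>g\<close>, \<open>w\<close> is a far point on the translated ray of \<open>u\<close>, and
    \<open>y = g\<^sup>p\<close> lies on the geodesic from \<open>\<one>\<close> to \<open>z\<close>.  Since \<open>z\<close> and \<open>w\<close> agree far beyond \<open>y\<close>, and
    \<open>\<one>\<close> and \<open>h\<close> are close compared with their distance from \<open>y\<close>, the four-point inequality replaces these ends one at a
    time and places \<open>y\<close> near the translated ray from \<open>h\<close> to \<open>w\<close>.\<close>
  have near: "\<exists>p0::nat. \<forall>p\<ge>p0. \<exists>q::nat. inv (g [^] p) \<otimes> (h \<otimes> u [^] q) \<in> B" if h: "h \<in> carrier G" for h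
  proof (rule exI, intro allI impI)
    fix p assume p: "p \<ge> nat \<lceil>real (L b h) + 2 * \<delta> + 1\<rceil>"
    let ?y = "g [^] p"
    have "p \<le> L b ?y" using g by simp
    with p have far: "real (L b h) + 2 * \<delta> < real (L b ?y)" by linarith
    obtain p' q' :: nat where big: "2 * real (L b ?y) + \<delta> < gp \<one> (g [^] p') (h \<otimes> u [^] q')"
      using unb[OF h] by blast
    let ?z = "g [^] p'" and ?w = "h \<otimes> u [^] q'"
    have G: "?y \<in> carrier G" "?z \<in> carrier G" "?w \<in> carrier G" using gpow upow h by auto
    have "real (L b ?y) < real (L b ?z)" using big gp_le[OF G(2,3)] base.delta_nonneg by linarith
    then have "p < p'" using g by simp
    then have "?z = ?y \<otimes> g [^] (p' - p)" using g by (simp add: nat_pow_mult)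
    moreover have "gp ?y \<one> (?y \<otimes> g [^] (p' - p)) = 0"
      using gp_one_at[OF G(1) gpow, of "p' - p"] g \<open>p < p'\<close>
      by (simp add: nat_pow_mult flip: of_nat_add distrib_right)
    ultimately have yz: "gp ?y \<one> ?z = 0" by simp
    have "\<delta> < gp ?y ?w ?z"
      using gp_change_base[of \<one> ?y ?z ?w] big G len.gdist_one[of ?y b] base.gp_commute[of ?z ?w ?y]
      by (simp del: of_nat_mult)
    then have yw: "gp ?y \<one> ?w \<le> \<delta>"
      using base.four_point[of ?y \<one> ?w ?z] yz G by (simp add: min_def split: if_splits)
    have "real (L b ?y) - real (L b h) \<le> gp ?y h \<one>"
    proof -
      have "real (L b ?y) \<le> real (L b h) + d b h ?y"
        using len.gdist_triangle[of \<one> h ?y b] len.gdist_one h G by simp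
      then show ?thesis using len.gdist_one[of h b] len.gdist_one[of ?y b] len.gdist_sym[of h \<one> b] h G
        by (simp add: gromov_product_def)
    qed
    then have "gp ?y h ?w \<le> 2 * \<delta>"
      using base.four_point[of ?y \<one> h ?w] yw far G h base.delta_nonneg
      by (simp add: min_def base.gp_commute split: if_splits)
    moreover have "base.geodesic_upto q' (real (L b u)) (\<lambda>i. h \<otimes> u [^] i)"
    proof -
      have up: "d b (u [^] i) (u [^] j) = real (L b u) * (real j - real i)" if "i \<le> j" for i j :: nat
        using len.gdist_mult_right[OF upow upow, of b i "j - i"] that u
        by (simp add: nat_pow_mult algebra_simps)
      have "d b (u [^] i) (u [^] j) = real (L b u) * \<bar>real i - real j\<bar>" for i j :: nat
        using up[of i j] up[of j i] len.gdist_sym[OF upow upow, of b i j] by (cases "i \<le> j") auto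
      then show ?thesis using h upow by (simp add: base.geodesic_upto_def len.gdist_translate)
    qed
    ultimately obtain t where "t \<le> q'" "d b ?y (h \<otimes> u [^] t) \<le> 2 * \<delta> + 2 * \<delta> + real (L b u)"
      using base.near_geodesic[of q' "real (L b u)" "\<lambda>i. h \<otimes> u [^] i" ?y "2 * \<delta>"] u h G by auto
    then have "real (L b (inv ?y \<otimes> (h \<otimes> u [^] t))) \<le> real K"
      unfolding left_metric_def K_def by linarith
    then show "\<exists>q::nat. inv ?y \<otimes> (h \<otimes> u [^] q) \<in> B"
      using G h upow unfolding B_def by (intro exI[of _ t]) auto
  qed
  obtain F where F: "F \<subseteq> rcosets ?H" "finite F" "card F = Suc (card B)"
    using infinite_arbitrarily_large[OF inf] by blast
  \<comment> \<open>The \<open>h\<close> attached to a right coset is the inverse of a representative, since \<open>h\<close> times a power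
    of \<open>u\<close> ranges over a left coset.\<close>
  have "\<forall>R\<in>F. \<exists>a. a \<in> carrier G \<and> R = ?H #> a" using F(1) by (auto simp: RCOSETS_def)
  then obtain a where a: "\<And>R. R \<in> F \<Longrightarrow> a R \<in> carrier G" "\<And>R. R \<in> F \<Longrightarrow> R = ?H #> a R" by metis
  have "\<forall>R\<in>F. \<exists>p0::nat. \<forall>p\<ge>p0. \<exists>q::nat. inv (g [^] p) \<otimes> (inv (a R) \<otimes> u [^] q) \<in> B"
    using near a by simp
  then obtain p0 :: "'a set \<Rightarrow> nat" where p0: "\<And>R p. R \<in> F \<Longrightarrow> p0 R \<le> p \<Longrightarrow> \<exists>q::nat. inv (g [^] p) \<otimes> (inv (a R) \<otimes> u [^] q) \<in> B"
    by metis
  define P where "P = Max (insert 0 (p0 ` F))"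
  have "p0 R \<le> P" if "R \<in> F" for R using that F by (simp add: P_def)
  with p0 have "\<forall>R\<in>F. \<exists>q::nat. inv (g [^] P) \<otimes> (inv (a R) \<otimes> u [^] q) \<in> B" by blast
  then obtain q :: "'a set \<Rightarrow> nat" where q: "\<And>R. R \<in> F \<Longrightarrow> inv (g [^] P) \<otimes> (inv (a R) \<otimes> u [^] q R) \<in> B"
    by metis
  have "inj_on (\<lambda>R. inv (g [^] P) \<otimes> (inv (a R) \<otimes> u [^] q R)) F"
  proof (rule inj_onI)
    fix R R' assume R: "R \<in> F" "R' \<in> F"
      and "inv (g [^] P) \<otimes> (inv (a R) \<otimes> u [^] q R) = inv (g [^] P) \<otimes> (inv (a R') \<otimes> u [^] q R')"
    then have eq: "inv (a R) \<otimes> u [^] q R = inv (a R') \<otimes> u [^] q R'"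
      using a gpow upow by simp
    have c: "a R \<in> carrier G" "a R' \<in> carrier G" using a R by auto
    have "u [^] q R' = a R' \<otimes> (inv (a R) \<otimes> u [^] q R)"
      using c upow by (simp add: eq mult_inv_cancel)
    then have "u [^] q R' \<otimes> inv (u [^] q R) \<otimes> a R
        = a R' \<otimes> (inv (a R) \<otimes> u [^] q R) \<otimes> inv (u [^] q R) \<otimes> a R" by (rule arg_cong)
    also have "\<dots> = a R'" using c upow by (simp add: m_assoc mult_inv_cancel)
    finally have "a R' = u [^] q R' \<otimes> inv (u [^] q R) \<otimes> a R" by (rule sym)
    moreover have "u [^] k \<in> ?H" for k :: nat
      using int_pow_int[of G u k] unfolding generate_pow[OF u(1)] by (intro CollectI exI[of _ "int k"]) auto
    then have "u [^] q R' \<otimes> inv (u [^] q R) \<in> ?H"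
      using H by (meson subgroup.m_closed subgroup.m_inv_closed)
    ultimately have "a R' \<in> ?H #> a R"
      using c by (auto simp: r_coset_def)
    then have "?H #> a R = ?H #> a R'" using repr_independence H c by blast
    then show "R = R'" using a(2)[OF R(1)] a(2)[OF R(2)] by simp
  qed
  then have "card F \<le> card B" by (rule card_inj_on_le) (use q finB in auto)
  with F show False by simp
qed

text \<open>If no \<open>f\<close> worked, then all \<open>h\<close> would satisfy the hypothesis of \<open>finite_index_if_powers_asymptotic\<close> for the inverse
  of \<open>u\<close> and for \<open>u'\<close>.\<close>

lemma translates_connect:
  assumes "\<not> virtually_cyclic G" "translates u v" "translates u' v'"
  obtains f c where "f \<in> carrier G" "\<And>(p::nat) (q::nat). gp \<one> (inv (u [^] p)) (f \<otimes> u' [^] q) \<le> c"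
proof -
  have u: "u \<in> carrier G" "\<And>p. L b (u [^] p) = p * L b u" "0 < L b u"
    and u': "u' \<in> carrier G" "\<And>p. L b (u' [^] p) = p * L b u'" "0 < L b u'"
    using assms by (auto simp: translates_def)
  have powi: "inv u [^] p = inv (u [^] p)" for p :: nat using u nat_pow_inv by simp
  have "\<exists>h\<in>carrier G. \<exists>c. \<forall>(p::nat) (q::nat). gp \<one> (inv u [^] p) (h \<otimes> u' [^] q) \<le> c"
  proof (rule ccontr)
    assume "\<not> ?thesis"
    then have unb: "\<exists>(p::nat) (q::nat). c < gp \<one> (inv u [^] p) (h \<otimes> u' [^] q)" if "h \<in> carrier G" for h c
      using that by (auto simp: not_le)
    have "finite (rcosets (generate G {u'}))"
      by (rule finite_index_if_powers_asymptotic[of "inv u" u', OF _ _ _ u' unb])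
        (use u powi len.len_inv in auto)
    then show False using virtually_cyclic_if_finite_index assms(1) u' by blast
  qed
  then obtain h c where hc: "h \<in> carrier G" "\<And>(p::nat) (q::nat). gp \<one> (inv u [^] p) (h \<otimes> u' [^] q) \<le> c"
    by blast
  show ?thesis by (rule that[of h c]) (use hc powi in simp_all)
qed

text \<open>The element is built from right to left.  The second property of \<open>x\<close>, that \<open>x\<close> starts along the powers of \<open>u v0\<close>, is what
  the induction needs: a new block \<open>u\<^sup>a f\<close> put in front of \<open>x\<close> does not backtrack into \<open>x\<close>, because it does not backtrack
  into the first block of \<open>x\<close> and that block is long.  This is where the lower bound \<open>N\<close> on the
  multiplicities comes from.\<close>

lemma translates_concatenate:
  fixes V :: "('m \<Rightarrow> real) set"
  assumes "\<not> virtually_cyclic G" "finite V" "V \<noteq> {}" "\<And>v. v \<in> V \<Longrightarrow> translates (u v) v"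
  shows "\<exists>v0\<in>V. \<exists>N. \<exists>C. \<forall>a :: ('m \<Rightarrow> real) \<Rightarrow> nat. (\<forall>v\<in>V. N \<le> a v) \<longrightarrow>
    (\<exists>x\<in>carrier G. (\<forall>j. \<bar>real (L j x) - (\<Sum>v\<in>V. real (a v) * v j)\<bar> \<le> C) \<and>
       real (a v0) - C \<le> gp \<one> (u v0 [^] a v0) x)"
  using assms(2-)
proof (induction V rule: finite_ne_induct)
  case (singleton v)
  then have v: "translates (u v) v" by simp
  then obtain C where C: "\<And>p j. \<bar>real (L j (u v [^] p)) - real p * v j\<bar> \<le> C"
    by (auto simp: translates_def)
  have c: "u v [^] p \<in> carrier G" and uG: "0 < L b (u v)" and Lp: "L b (u v [^] p) = p * L b (u v)" for p :: nat
    using v by (auto simp: translates_def)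
  have C0: "0 \<le> C" using C[of b 0] by (meson abs_ge_zero order_trans)
  have "real p \<le> gp \<one> (u v [^] p) (u v [^] p)" for p
  proof -
    have "gp \<one> (u v [^] p) (u v [^] p) = real (p * L b (u v))"
      using c[of p] Lp[of p] len.gdist_sym[of "u v [^] p" \<one> b] len.gdist_one[of "u v [^] p" b]
      by (simp add: gromov_product_def len.gdist_self)
    moreover have "p \<le> p * L b (u v)" using uG by simp
    ultimately show ?thesis by linarith
  qed
  then have *: "real p - C \<le> gp \<one> (u v [^] p) (u v [^] p)" for p
    using C0 by (smt (verit))
  show ?case
  proof (intro bexI[of _ v] exI[of _ "0::nat"] exI[of _ C] allI impI)
    fix a :: "('m \<Rightarrow> real) \<Rightarrow> nat"
    show "\<exists>x\<in>carrier G. (\<forall>j. \<bar>real (L j x) - (\<Sum>v\<in>{v}. real (a v) * v j)\<bar> \<le> C) \<and>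
        real (a v) - C \<le> gp \<one> (u v [^] a v) x"
      by (rule bexI[OF _ c[of "a v"]]) (simp add: C *)
  qed simp
next
  case (insert v F)
  then have v: "translates (u v) v" by simp
  then obtain C1 where C1: "\<And>p j. \<bar>real (L j (u v [^] p)) - real p * v j\<bar> \<le> C1"
    by (auto simp: translates_def)
  have c: "u v [^] p \<in> carrier G" and uG: "0 < L b (u v)" and Lp: "L b (u v [^] p) = p * L b (u v)" for p :: nat
    using v by (auto simp: translates_def)
  have "\<exists>v0\<in>F. \<exists>N. \<exists>C. \<forall>a :: ('m \<Rightarrow> real) \<Rightarrow> nat. (\<forall>v\<in>F. N \<le> a v) \<longrightarrow>
    (\<exists>x\<in>carrier G. (\<forall>j. \<bar>real (L j x) - (\<Sum>v\<in>F. real (a v) * v j)\<bar> \<le> C) \<and>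
       real (a v0) - C \<le> gp \<one> (u v0 [^] a v0) x)"
    by (rule insert.IH) (use insert.prems in blast)
  then obtain v0 N C where v0: "v0 \<in> F" and IH: "\<And>a :: ('m \<Rightarrow> real) \<Rightarrow> nat. (\<forall>v\<in>F. N \<le> a v) \<Longrightarrow>
    (\<exists>x\<in>carrier G. (\<forall>j. \<bar>real (L j x) - (\<Sum>v\<in>F. real (a v) * v j)\<bar> \<le> C) \<and>
       real (a v0) - C \<le> gp \<one> (u v0 [^] a v0) x)"
    by blast
  have tr0: "translates (u v0) v0" using insert.prems v0 by simp
  then have c0: "u v0 [^] p \<in> carrier G" for p :: nat by (auto simp: translates_def)
  obtain f c1 where f: "f \<in> carrier G" "\<And>(p::nat) (q::nat). gp \<one> (inv (u v [^] p)) (f \<otimes> u v0 [^] q) \<le> c1"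
    using translates_connect[OF assms(1) v tr0] by blast
  obtain A where A: "\<And>j x w. x \<in> carrier G \<Longrightarrow> w \<in> carrier G \<Longrightarrow> gp x \<one> (x \<otimes> w) \<le> c1 + \<delta> \<Longrightarrow>
    L j x + L j w \<le> L j (x \<otimes> w) + A"
    using lengths_nearly_additive by blast
  define M where "M = Max (range (\<lambda>j. L j f))"
  have M: "L j f \<le> M" for j by (simp add: M_def)
  define N' where "N' = max N (nat \<lceil>C + real M + c1 + \<delta> + 1\<rceil>)"
  define C' where "C' = max (C + C1 + real A + real M) (c1 + \<delta>)"
  show ?case
  proof (intro bexI[of _ v] exI[of _ N'] exI[of _ C'] allI impI)
    fix a :: "('m \<Rightarrow> real) \<Rightarrow> nat" assume a: "\<forall>v\<in>insert v F. N' \<le> a v"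
    then have "\<forall>v\<in>F. N \<le> a v" by (simp add: N'_def)
    then obtain y where y: "y \<in> carrier G" "\<And>j. \<bar>real (L j y) - (\<Sum>v\<in>F. real (a v) * v j)\<bar> \<le> C"
      "real (a v0) - C \<le> gp \<one> (u v0 [^] a v0) y" using IH by blast
    let ?p = "u v [^] a v" and ?q = "u v0 [^] a v0"
    define x where "x = ?p \<otimes> (f \<otimes> y)"
    have G: "?p \<in> carrier G" "?q \<in> carrier G" "f \<otimes> y \<in> carrier G" "x \<in> carrier G" "f \<otimes> ?q \<in> carrier G"
      using c c0 f y by (auto simp: x_def)
    have "N' \<le> a v0" using a v0 by simp
    then have big: "C + real M + c1 + \<delta> < real (a v0)" unfolding N'_def by linarith
    have "gp \<one> ?q y - real (L b f) \<le> gp \<one> (f \<otimes> ?q) (f \<otimes> y)"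
    proof -
      have "gp \<one> ?q y = gp f (f \<otimes> ?q) (f \<otimes> y)" using gp_translate[of f \<one> ?q y] f G y by simp
      then show ?thesis
        using gp_change_base[of f \<one> "f \<otimes> ?q" "f \<otimes> y"] f G len.gdist_sym[of f \<one> b] len.gdist_one by simp
    qed
    then have "c1 + \<delta> < gp \<one> (f \<otimes> ?q) (f \<otimes> y)" using y(3) big M[of b] by linarith
    then have "gp \<one> (inv ?p) (f \<otimes> y) \<le> c1 + \<delta>"
      using base.four_point[of \<one> "inv ?p" "f \<otimes> y" "f \<otimes> ?q"] f(2)[of "a v" "a v0"] G
        base.gp_commute[of "f \<otimes> ?q" "f \<otimes> y" \<one>]
      by (simp add: min_def split: if_splits)
    moreover have "gp \<one> (inv ?p) (f \<otimes> y) = gp ?p \<one> x"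
      using gp_translate[of ?p \<one> "inv ?p" "f \<otimes> y"] G by (simp add: x_def)
    ultimately have px: "gp ?p \<one> x \<le> c1 + \<delta>" by simp
    have "\<bar>real (L j x) - (\<Sum>v\<in>insert v F. real (a v) * v j)\<bar> \<le> C'" for j
    proof -
      have "L j ?p + L j (f \<otimes> y) \<le> L j x + A" using A[of ?p "f \<otimes> y" j] G px by (simp add: x_def)
      moreover have "L j x \<le> L j ?p + L j (f \<otimes> y)" using len.len_mult G by (simp add: x_def)
      moreover have "L j (f \<otimes> y) \<le> L j f + L j y" using len.len_mult f y by blast
      moreover have "L j y \<le> L j f + L j (f \<otimes> y)"
        using len.len_mult[of "inv f" "f \<otimes> y" j] f y len.len_inv inv_mult_cancel_left by simp
      ultimately have "\<bar>real (L j x) - real (L j ?p) - real (L j y)\<bar> \<le> real A + real M"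
        using M[of j] by linarith
      moreover have "(\<Sum>v\<in>insert v F. real (a v) * v j) = real (a v) * v j + (\<Sum>v\<in>F. real (a v) * v j)"
        using insert by simp
      ultimately show ?thesis using C1[of j "a v"] y(2)[of j] unfolding C'_def by linarith
    qed
    moreover have "real (a v) - C' \<le> gp \<one> ?p x"
    proof -
      have "gp \<one> ?p x + gp ?p \<one> x = real (L b ?p)"
        using G len.gdist_one[of ?p b] len.gdist_one[of x b] len.gdist_sym[of \<one> ?p b]
          len.gdist_sym[of x ?p b] len.gdist_sym[of \<one> x b]
        by (simp add: gromov_product_def field_simps)
      moreover have "a v \<le> L b ?p" using Lp uG by simp
      ultimately show ?thesis using px unfolding C'_def by linarith
    qed
    ultimately show "\<exists>x\<in>carrier G. (\<forall>j. \<bar>real (L j x) - (\<Sum>v\<in>insert v F. real (a v) * v j)\<bar> \<le> C') \<and>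
       real (a v) - C' \<le> gp \<one> ?p x" using G by blast
  qed simp
qed

end

section \<open>The spectrum as a convex hull of translation vectors\<close>

lemma hausdorff_distance_leI:
  assumes "\<And>a. a \<in> A \<Longrightarrow> \<exists>b\<in>B. dist a b \<le> e" "\<And>b. b \<in> B \<Longrightarrow> \<exists>a\<in>A. dist a b \<le> e"
  shows "hausdorff_distance A B \<le> ennreal e"
  unfolding hausdorff_distance_def
proof (intro max.boundedI SUP_least)
  fix a assume "a \<in> A"
  then obtain b where "b \<in> B" "dist a b \<le> e" using assms by blast
  then show "(INF b\<in>B. ennreal (dist a b)) \<le> ennreal e"
    by (intro INF_lower2[of b]) (auto simp: ennreal_leI)
next
  fix b assume "b \<in> B"
  then obtain a where "a \<in> A" "dist a b \<le> e" using assms by blast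
  then show "(INF a\<in>A. ennreal (dist a b)) \<le> ennreal e"
    by (intro INF_lower2[of a]) (auto simp: ennreal_leI)
qed

text \<open>The vector \<open>y / n\<close> is compared with \<open>p\<close> through \<open>t p\<close>, where \<open>t\<close> is an approximation of \<open>n\<close>.\<close>

lemma dist_ratio_le:
  fixes p :: "real^'n" and y :: "'n \<Rightarrow> real"
  assumes "norm p \<le> M" "0 < n" "\<bar>n - t\<bar> \<le> C" "\<And>i. \<bar>y i - t * p $ i\<bar> \<le> C"
  shows "dist (\<chi> i. y i / n) p \<le> real CARD('n) * (C * (1 + M)) / n"
proof -
  have "\<bar>y i / n - p $ i\<bar> \<le> C * (1 + M) / n" for i
  proof -
    have pM: "\<bar>p $ i\<bar> \<le> M" using component_le_norm_cart[of p i] assms(1) by linarith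
    have "y i / n - p $ i = ((y i - t * p $ i) - (n - t) * p $ i) / n"
      using assms(2) by (simp add: field_simps)
    moreover have "\<bar>(n - t) * p $ i\<bar> \<le> C * M"
      unfolding abs_mult using assms(3) pM by (intro mult_mono) auto
    then have "\<bar>(y i - t * p $ i) - (n - t) * p $ i\<bar> \<le> C * (1 + M)"
      using assms(4)[of i] by (simp add: algebra_simps)
    ultimately show ?thesis using assms(2) by (simp add: divide_right_mono)
  qed
  then have "(\<Sum>i\<in>UNIV. \<bar>((\<chi> i. y i / n) - p) $ i\<bar>) \<le> (\<Sum>i\<in>(UNIV :: 'n set). C * (1 + M) / n)"
    by (intro sum_mono) simp
  then have "norm ((\<chi> i. y i / n) - p) \<le> (\<Sum>i\<in>(UNIV :: 'n set). C * (1 + M) / n)"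
    using norm_le_l1_cart order_trans by blast
  then show ?thesis by (simp add: dist_norm)
qed

text \<open>Coefficients are indexed by \<open>V\<close> and not by the image, since \<open>P\<close> may identify elements of \<open>V\<close>.\<close>

lemma convex_hull_image_finite:
  assumes "finite V"
  shows "convex hull (P ` V) = {\<Sum>v\<in>V. c v *\<^sub>R P v | c. (\<forall>v\<in>V. 0 \<le> c v) \<and> sum c V = 1}"
    (is "_ = ?Q")
proof
  show "convex hull (P ` V) \<subseteq> ?Q"
  proof (rule hull_minimal)
    show "P ` V \<subseteq> ?Q"
    proof clarify
      fix w assume w: "w \<in> V"
      have "(\<Sum>v\<in>V. (if v = w then 1 else 0) *\<^sub>R P v) = (\<Sum>v\<in>V. if v = w then P v else 0)"
        by (intro sum.cong) auto
      then show "\<exists>c. P w = (\<Sum>v\<in>V. c v *\<^sub>R P v) \<and> (\<forall>v\<in>V. 0 \<le> c v) \<and> sum c V = 1"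
        using w assms by (intro exI[of _ "\<lambda>v. if v = w then 1 else 0"]) auto
    qed
    show "convex ?Q"
    proof (rule convexI, clarify)
      fix s t :: real and c c' :: "'a \<Rightarrow> real"
      assume st: "0 \<le> s" "0 \<le> t" "s + t = 1"
        and c: "\<forall>v\<in>V. 0 \<le> c v" "sum c V = 1" "\<forall>v\<in>V. 0 \<le> c' v" "sum c' V = 1"
      show "\<exists>c''. s *\<^sub>R (\<Sum>v\<in>V. c v *\<^sub>R P v) + t *\<^sub>R (\<Sum>v\<in>V. c' v *\<^sub>R P v) = (\<Sum>v\<in>V. c'' v *\<^sub>R P v)
          \<and> (\<forall>v\<in>V. 0 \<le> c'' v) \<and> sum c'' V = 1"
        using st c
        by (intro exI[of _ "\<lambda>v. s * c v + t * c' v"])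
          (simp add: scaleR_sum_right scaleR_add_left sum.distrib sum_distrib_left[symmetric])
    qed
  qed
  show "?Q \<subseteq> convex hull (P ` V)"
    using assms by (clarify, intro convex_sum convex_convex_hull) (auto intro: hull_inc)
qed

text \<open>The base length carries the index \<open>None\<close>.  A sum of translation vectors with multiplicities \<open>a\<close> is sent by the ratio
  map to the convex combination with weights \<open>a v * v None / \<sigma>\<close>.  Conversely the weights \<open>c\<close> of a point of the hull
  are realised at scale \<open>T\<close> by the integer parts of \<open>T * c v / v None\<close>.  Both steps cost a bounded error in the lengths, and
  so an error of order \<open>1 / T\<close> in the ratios, uniformly over the hull.\<close>

lemma polytope_is_joint_translation_limit:
  fixes L :: "'n::finite option \<Rightarrow> 'a \<Rightarrow> nat"
  assumes "hyperbolic_lengths G L None \<delta>" and nvc: "\<not> virtually_cyclic G"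
  shows "\<exists>J. polytope J \<and>
    is_joint_translation_limit G (left_metric G (L None)) (\<lambda>i. left_metric G (L (Some i))) J"
proof -
  interpret hyperbolic_lengths G L None \<delta> by fact
  have inf: "infinite (carrier G)"
  proof
    assume "finite (carrier G)"
    then have "finite (rcosets\<^bsub>G\<^esub> (generate G {\<one>\<^bsub>G\<^esub>}))" by (simp add: RCOSETS_def)
    then show False using virtually_cyclic_if_finite_index[of "\<one>\<^bsub>G\<^esub>"] nvc by simp
  qed
  obtain V :: "('n option \<Rightarrow> real) set" and C :: real where V: "finite V" "V \<noteq> {}"
    and tr: "\<And>v. v \<in> V \<Longrightarrow> \<exists>u. translates u v"
    and dec: "\<And>x. x \<in> carrier G \<Longrightarrow> \<exists>a :: ('n option \<Rightarrow> real) \<Rightarrow> nat.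
       \<forall>j. \<bar>real (L j x) - (\<Sum>v\<in>V. real (a v) * v j)\<bar> \<le> C"
    using lengths_decompose[OF inf] by blast
  obtain u where u: "\<And>v. v \<in> V \<Longrightarrow> translates (u v) v" using tr by metis
  have pos: "0 < v None" if "v \<in> V" for v using u[OF that] by (simp add: translates_def)
  obtain N C' where cat: "\<And>a :: ('n option \<Rightarrow> real) \<Rightarrow> nat. (\<forall>v\<in>V. N \<le> a v) \<Longrightarrow>
      \<exists>x\<in>carrier G. \<forall>j. \<bar>real (L j x) - (\<Sum>v\<in>V. real (a v) * v j)\<bar> \<le> C'"
    using translates_concatenate[OF nvc V u] by blast
  define P :: "('n option \<Rightarrow> real) \<Rightarrow> real^'n" where "P v = (\<chi> i. v (Some i) / v None)" for v
  define J where "J = convex hull (P ` V)"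
  have J_eq: "J = {\<Sum>v\<in>V. c v *\<^sub>R P v | c. (\<forall>v\<in>V. 0 \<le> c v) \<and> sum c V = 1}"
    unfolding J_def by (rule convex_hull_image_finite[OF V(1)])
  define M where "M = (\<Sum>v\<in>V. norm (P v))"
  have "P ` V \<subseteq> cball 0 M"
    using V(1) by (auto simp: M_def intro!: member_le_sum)
  then have "J \<subseteq> cball 0 M" unfolding J_def by (intro hull_minimal convex_cball)
  then have JM: "norm p \<le> M" if "p \<in> J" for p using that by auto
  have "0 \<le> M" by (simp add: M_def sum_nonneg)
  let ?D = "displacement_ratio G (left_metric G (L None)) (\<lambda>i. left_metric G (L (Some i)))"
  have D_eq: "?D x = (\<chi> i. real (L (Some i) x) / real (L None x))" if "x \<in> carrier G" for x
    using that by (simp add: displacement_ratio_def len.gdist_one)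
  define E where "E B = real CARD('n) * (B * (1 + M))" for B
  have E_nonneg: "0 \<le> E B" if "0 \<le> B" for B using that \<open>0 \<le> M\<close> by (simp add: E_def)
  have C_nonneg: "0 \<le> C" using dec[of "\<one>\<^bsub>G\<^esub>"] by fastforce
  have upper: "\<exists>p\<in>J. dist (?D x) p \<le> E C / real (L None x)"
    if x: "x \<in> carrier G" and big: "C < real (L None x)" for x
  proof -
    obtain a :: "('n option \<Rightarrow> real) \<Rightarrow> nat"
      where a: "\<And>j. \<bar>real (L j x) - (\<Sum>v\<in>V. real (a v) * v j)\<bar> \<le> C"
      using dec[OF x] by blast
    define \<sigma> where "\<sigma> = (\<Sum>v\<in>V. real (a v) * v None)"
    have \<sigma>: "0 < \<sigma>" using a[of None] big by (simp add: \<sigma>_def)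
    define c where "c v = real (a v) * v None / \<sigma>" for v
    define p where "p = (\<Sum>v\<in>V. c v *\<^sub>R P v)"
    have "sum c V = 1" using \<sigma> by (simp add: c_def \<sigma>_def flip: sum_divide_distrib)
    moreover have "\<forall>v\<in>V. 0 \<le> c v" using \<sigma> pos by (simp add: c_def less_imp_le)
    ultimately have "p \<in> J" unfolding J_eq p_def by blast
    have "\<sigma> * p $ i = (\<Sum>v\<in>V. real (a v) * v (Some i))" for i
    proof -
      have "\<sigma> * p $ i = (\<Sum>v\<in>V. \<sigma> * (c v * (v (Some i) / v None)))"
        by (simp add: p_def P_def sum_distrib_left)
      also have "\<dots> = (\<Sum>v\<in>V. real (a v) * v (Some i))"
      proof (rule sum.cong)
        fix v assume "v \<in> V"
        then have "v None \<noteq> 0" using pos by force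
        then show "\<sigma> * (c v * (v (Some i) / v None)) = real (a v) * v (Some i)"
          using \<sigma> by (simp add: c_def)
      qed simp
      finally show ?thesis .
    qed
    then have "dist (\<chi> i. real (L (Some i) x) / real (L None x)) p \<le> real CARD('n) * (C * (1 + M)) / real (L None x)"
      using a JM[OF \<open>p \<in> J\<close>] big C_nonneg
      by (intro dist_ratio_le[where t = \<sigma>]) (auto simp: \<sigma>_def)
    with \<open>p \<in> J\<close> show ?thesis using D_eq[OF x] by (auto simp: E_def)
  qed
  define R0 where "R0 = \<bar>C'\<bar> + 1 + (\<Sum>j\<in>UNIV. \<Sum>v\<in>V. (real N + 1) * \<bar>v j\<bar>)"
  have "0 \<le> (\<Sum>j\<in>UNIV. \<Sum>v\<in>V. (real N + 1) * \<bar>v j\<bar>)" by (intro sum_nonneg) auto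
  then have "0 < R0" unfolding R0_def by linarith
  have lower: "\<exists>x\<in>carrier G. \<bar>real (L None x) - T\<bar> \<le> R0 \<and> (\<forall>i. \<bar>real (L (Some i) x) - T * p $ i\<bar> \<le> R0)"
    if p: "p \<in> J" and T: "0 \<le> T" for p T
  proof -
    obtain c where c: "p = (\<Sum>v\<in>V. c v *\<^sub>R P v)" "\<forall>v\<in>V. 0 \<le> c v" "sum c V = 1"
      using p unfolding J_eq by blast
    \<comment> \<open>The summand \<open>N\<close> makes every multiplicity large enough for concatenation, even if \<open>c v = 0\<close>.\<close>
    define a :: "('n option \<Rightarrow> real) \<Rightarrow> nat" where "a v = N + nat \<lfloor>T * c v / v None\<rfloor>" for v
    have a_approx: "\<bar>real (a v) - T * c v / v None\<bar> \<le> real N + 1" if "v \<in> V" for v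
    proof -
      have "0 \<le> T * c v / v None" using T c that pos by (simp add: less_imp_le)
      then show ?thesis unfolding a_def by (simp add: abs_le_iff) linarith
    qed
    obtain x where x: "x \<in> carrier G" "\<And>j. \<bar>real (L j x) - (\<Sum>v\<in>V. real (a v) * v j)\<bar> \<le> C'"
      using cat[of a] by (auto simp: a_def)
    have est: "\<bar>real (L j x) - (\<Sum>v\<in>V. T * c v / v None * v j)\<bar> \<le> R0" for j
    proof -
      have "\<bar>(\<Sum>v\<in>V. real (a v) * v j) - (\<Sum>v\<in>V. T * c v / v None * v j)\<bar>
          = \<bar>\<Sum>v\<in>V. (real (a v) - T * c v / v None) * v j\<bar>"
        by (simp add: sum_subtractf left_diff_distrib)
      also have "\<dots> \<le> (\<Sum>v\<in>V. (real N + 1) * \<bar>v j\<bar>)"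
      proof (rule sum_abs[THEN order_trans], rule sum_mono)
        fix v assume "v \<in> V"
        then show "\<bar>(real (a v) - T * c v / v None) * v j\<bar> \<le> (real N + 1) * \<bar>v j\<bar>"
          unfolding abs_mult by (intro mult_right_mono a_approx) auto
      qed
      also have "\<dots> \<le> (\<Sum>j\<in>UNIV. \<Sum>v\<in>V. (real N + 1) * \<bar>v j\<bar>)"
        by (rule member_le_sum) (auto intro!: sum_nonneg)
      finally show ?thesis using x(2)[of j] unfolding R0_def by linarith
    qed
    have "(\<Sum>v\<in>V. T * c v / v None * v None) = (\<Sum>v\<in>V. T * c v)"
      by (intro sum.cong) (use pos in force)+
    then have "(\<Sum>v\<in>V. T * c v / v None * v None) = T"
      using c(3) by (simp flip: sum_distrib_left)
    moreover have "(\<Sum>v\<in>V. T * c v / v None * v (Some i)) = T * p $ i" for i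
      by (simp add: c(1) P_def sum_distrib_left mult.assoc)
    ultimately show ?thesis using est[of None] est[of "Some _"] x(1) by (intro bexI[of _ x]) auto
  qed
  have "is_joint_translation_limit G (left_metric G (L None)) (\<lambda>i. left_metric G (L (Some i))) J"
    unfolding is_joint_translation_limit_def
  proof (intro conjI exI[of _ R0] allI impI)
    show "compact J" unfolding J_def using V by (intro finite_imp_compact_convex_hull) auto
    show "0 < R0" by fact
    fix R assume R: "R0 \<le> R"
    let ?A = "\<lambda>T. ?D ` thick_sphere G (left_metric G (L None)) R T"
    define B where "B = max C R0"
    have EB: "E C \<le> E B" "E R0 \<le> E B"
      using \<open>0 \<le> M\<close> by (auto simp: E_def B_def intro!: mult_left_mono mult_right_mono)
    have sphere: "x \<in> thick_sphere G (left_metric G (L None)) R T \<longleftrightarrow>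
        x \<in> carrier G \<and> \<bar>real (L None x) - T\<bar> \<le> R \<and> 0 < L None x" for x T
      by (auto simp: thick_sphere_def len.gdist_one)
    have bound: "hausdorff_distance (?A T) J \<le> ennreal (E B / (T - R))" if T: "R + C + 1 \<le> T" for T
    proof -
      have mono: "E B' / real n \<le> E B / (T - R)" if "E B' \<le> E B" "T - R \<le> real n" "0 \<le> B'" for B' n
        using that T C_nonneg E_nonneg[of B'] by (intro frac_le) auto
      show ?thesis
      proof (rule hausdorff_distance_leI)
        fix y assume "y \<in> ?A T"
        then obtain x where x: "x \<in> carrier G" "\<bar>real (L None x) - T\<bar> \<le> R" and y: "y = ?D x"
          by (auto simp: sphere)
        then obtain p where "p \<in> J" "dist y p \<le> E C / real (L None x)" using upper[of x] T by force
        moreover have "T - R \<le> real (L None x)" using x by linarith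
        ultimately show "\<exists>p\<in>J. dist y p \<le> E B / (T - R)"
          using mono[OF EB(1), of "L None x"] C_nonneg by (intro bexI[of _ p]) auto
      next
        fix p assume p: "p \<in> J"
        have "0 \<le> T" using T R \<open>0 < R0\<close> C_nonneg by linarith
        then obtain x where x: "x \<in> carrier G" "\<bar>real (L None x) - T\<bar> \<le> R0"
          "\<And>i. \<bar>real (L (Some i) x) - T * p $ i\<bar> \<le> R0" using lower[OF p] by blast
        have n: "T - R \<le> real (L None x)" "0 < real (L None x)" using x(2) R T C_nonneg by linarith+
        have "dist (\<chi> i. real (L (Some i) x) / real (L None x)) p \<le> E R0 / real (L None x)"
          unfolding E_def using x JM[OF p] n by (intro dist_ratio_le[where t = T]) auto
        also have "\<dots> \<le> E B / (T - R)" using mono[OF EB(2) n(1)] \<open>0 < R0\<close> by simp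
        finally have "dist (?D x) p \<le> E B / (T - R)" using D_eq[OF x(1)] by simp
        moreover have "?D x \<in> ?A T" using x R n by (intro imageI) (auto simp: sphere)
        ultimately show "\<exists>y\<in>?A T. dist y p \<le> E B / (T - R)" by blast
      qed
    qed
    have "((\<lambda>T. E B / (T - R)) \<longlongrightarrow> 0) at_top" by real_asymp
    then have "((\<lambda>T. ennreal (E B / (T - R))) \<longlongrightarrow> 0) at_top"
      using tendsto_ennrealI by fastforce
    then show "((\<lambda>T. hausdorff_distance (?A T) J) \<longlongrightarrow> 0) at_top"
      by (rule tendsto_sandwich[OF _ _ tendsto_const, rotated 2])
        (use bound in \<open>auto simp: eventually_at_top_linorder\<close>)
  qed
  moreover have "polytope J" unfolding J_def polytope_def using V(1) by blast
  ultimately show ?thesis by blast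
qed

lemma hyperbolic_distance_word_metric:
  assumes "group G" "finite_symmetric_generating_set G S"
    and "gromov_hyperbolic (carrier G) (word_metric G S)"
  obtains \<delta> where "hyperbolic_distance (carrier G) (left_metric G (word_length G S)) \<delta>"
proof -
  interpret length_function G "word_length G S"
    using length_function_word_length assms by blast
  have eq: "word_metric G S = left_metric G (word_length G S)"
    by (intro ext) (simp add: word_metric_def left_metric_def)
  obtain \<delta> where \<delta>: "\<delta> \<ge> 0" "\<forall>w\<in>carrier G. \<forall>x\<in>carrier G. \<forall>y\<in>carrier G. \<forall>z\<in>carrier G.
      gromov_product gdist w x z \<ge> min (gromov_product gdist w x y) (gromov_product gdist w y z) - \<delta>"
    using assms(3) unfolding gromov_hyperbolic_def eq by blast
  have "hyperbolic_distance (carrier G) gdist \<delta>"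
  proof
    show "min (gromov_product gdist w x y) (gromov_product gdist w y z) \<le> gromov_product gdist w x z + \<delta>"
      if "w \<in> carrier G" "x \<in> carrier G" "y \<in> carrier G" "z \<in> carrier G" for w x y z
      using \<delta>(2) that by (simp add: diff_le_eq)
  qed (use \<delta>(1) gdist_self gdist_sym gdist_triangle in auto)
  then show ?thesis by (rule that)
qed

theorem proposition7p1:
  fixes G :: "('a, 'b) monoid_scheme"
    and S :: "'a set"
    and Ss :: "'n::finite \<Rightarrow> 'a set"
  assumes "non_elementary_hyperbolic_group G"
    and "finite_symmetric_generating_set G S"
    and "\<And>i. finite_symmetric_generating_set G (Ss i)"
  shows "polytope (joint_translation_spectrum G (word_metric G S) (\<lambda>i. word_metric G (Ss i)))"
proof -
  have G: "group G" "gromov_hyperbolic (carrier G) (word_metric G S)" "\<not> virtually_cyclic G"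
    using assms(1,2) by (auto simp: non_elementary_hyperbolic_group_def)
  obtain \<delta> where \<delta>: "hyperbolic_distance (carrier G) (left_metric G (word_length G S)) \<delta>"
    using hyperbolic_distance_word_metric G assms(2) by blast
  define L where "L = case_option (word_length G S) (\<lambda>i. word_length G (Ss i))"
  have "length_function G (L j)" for j
    using length_function_word_length[OF G(1)] assms(2,3) by (cases j) (auto simp: L_def)
  then have "hyperbolic_lengths G L None \<delta>"
    using G(1) \<delta> by (simp add: hyperbolic_lengths_def hyperbolic_lengths_axioms_def L_def)
  then obtain J where J: "polytope J"
      "is_joint_translation_limit G (left_metric G (L None)) (\<lambda>i. left_metric G (L (Some i))) J"
    using polytope_is_joint_translation_limit G(3) by blast
  have "word_metric G U = left_metric G (word_length G U)" for U
    by (intro ext) (simp add: word_metric_def left_metric_def)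
  with J(2) have "is_joint_translation_limit G (word_metric G S) (\<lambda>i. word_metric G (Ss i)) J"
    by (simp add: L_def)
  with J(1) show ?thesis using joint_translation_spectrum_eqI by metis
qed

end
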